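(* Let $f:\mathbb{R}^d\to\mathbb{R}$ be continuously differentiable with Lipschitz continuous gradient with constant $L_1>0$, i.e. $\|\nabla f(z_1)-\nabla f(z_2)\|_*\le L_1\|z_1-z_2\|$ for all $z_1,z_2\in\mathbb{R}^d$, where $B=\lambda\mathbf{I}$ with $\lambda>0$. Let $\mu>0$ and let $\sigma\ge 0$ satisfy $E_u[\|G_\mu(z;u)-F_\mu(z)\|_*^2]\le\sigma^2$ for all $z\in\mathbb{R}^d$. Suppose that for some $\rho\in[0,\frac{1}{8L_1})$ there is $z^*\in\mathbb{R}^d$ such that $\langle F(z),z-z^*\rangle+\frac{\rho}{2}\|F(z)\|_*^2\ge 0$ for all $z\in\mathbb{R}^d$. Let $\{z_k\},\{\hat z_k\}$ be generated by the variance-reduced zeroth-order extragradient algorithm (unconstrained) with constant sample size $t_k=t\in\mathbb{N}$, $t\ge1$, and constant step sizes $h_1,h_2>0$ satisfying $h_1\le\frac{1}{L_1\lambda}$ and $h_2\in\left(\sqrt{\frac{2\rho}{L_1\lambda^2}},\frac{h_1}{2}\right]$. Let $r_0=|z_0-z^*|$ and let $\epsilon>0$. If $$t\ge\left\lceil\frac{18\lambda\sigma^2}{L_1(\lambda^2L_1h_2^2-2\rho)}\epsilon^{-2}\right\rceil,\qquad N\ge\left\lceil\left(\frac{12\lambda^2L_1r_0^2}{\lambda^2L_1h_2^2-2\rho}\right)\epsilon^{-2}-1\right\rceil,$$ $$\mu\le\min\left\{\frac{\epsilon}{\sqrt{3}\,\lambda L_1(d+3)^{3/2}},\ \left(\frac{\lambda^2L_1h_2^2-2\rho}{24\lambda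 L_1d+24\lambda L_1^2\rho(d+3)^3}\right)^{1/2}\epsilon\right\},$$ then $$\frac{1}{N+1}\sum_{k=0}^{N}E_{\mathcal{U}_k}[|F(\hat z_k)|^2]\le\epsilon^2.$$
   Context: $n,m\in\mathbb{N}$, $d=n+m$, points $z=(x,y)\in\mathbb{R}^n\times\mathbb{R}^m=\mathbb{R}^d$. $B=\lambda\mathbf{I}$ with $\lambda>0$. $\langle\cdot,\cdot\rangle$ is the Euclidean inner product, $|z|=\langle z,z\rangle^{1/2}$, $\|z\|=\langle z,Bz\rangle^{1/2}=\sqrt{\lambda}|z|$, $\|z\|_*=\langle z,B^{-1}z\rangle^{1/2}=|z|/\sqrt{\lambda}$. $F(z)=(\nabla_x f(z),-\nabla_y f(z))$. For $\mu>0$ the Gaussian smoothing of $f$ is $f_\mu(z)=E_u[f(z+\mu u)]$ with $u\sim\mathcal{N}(0,B^{-1})$, and $F_\mu(z)=(\nabla_x f_\mu(z),-\nabla_y f_\mu(z))$. For $u=(u_1,u_2)\in\mathbb{R}^n\times\mathbb{R}^m$ the random oracle is $G_\mu(z;u)=\frac{f(z+\mu u)-f(z)}{\mu}\,(\lambda u_1,-\lambda u_2)$. Variance-reduced ZO-EG (unconstrained): given $z_0\in\mathbb{R}^d$, for $k=0,1,\dots,N$: sample $\hat u_k^1,\dots,\hat u_k^{t_k}\sim\mathcal{N}(0,B^{-1})$ and set $\hat z_k=z_k-h_1\frac{1}{t_k}\sum_{i=1}^{t_k}G_\mu(z_k;\hat u_k^i)$; sample $u_k^1,\dots,u_k^{t_k}\sim\mathcal{N}(0,B^{-1})$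 and set $z_{k+1}=z_k-h_2\frac{1}{t_k}\sum_{i=1}^{t_k}G_\mu(\hat z_k;u_k^i)$. All sampled vectors are independent. $\mathcal{U}_k=[(u_0,\hat u_0),\dots,(u_k,\hat u_k)]$, where $u_j,\hat u_j$ denote the batches sampled at iteration $j$, and $E_{\mathcal{U}_k}$ is expectation over $\mathcal{U}_k$. *)

theory Defs
  imports "HOL-Probability.Probability"
begin

definition B_norm :: "real \<Rightarrow> 'a::real_inner \<Rightarrow> real" where
  "B_norm lam z = sqrt (z \<bullet> (lam *\<^sub>R z))"

definition B_dual_norm :: "real \<Rightarrow> 'a::real_inner \<Rightarrow> real" where
  "B_dual_norm lam z = sqrt (z \<bullet> ((1 / lam) *\<^sub>R z))"

text \<open>The gradient is taken with respect to the Euclidean inner product; the value is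
  unspecified at points where the function is not differentiable.\<close>

definition grad :: "('a::real_inner \<Rightarrow> real) \<Rightarrow> 'a \<Rightarrow> 'a" where
  "grad f z = (THE D. GDERIV f z :> D)"

definition saddle_op ::
  "('a::real_inner \<times> 'b::real_inner \<Rightarrow> real) \<Rightarrow> 'a \<times> 'b \<Rightarrow> 'a \<times> 'b" where
  "saddle_op f z =
     (grad (\<lambda>x. f (x, snd z)) (fst z), - grad (\<lambda>y. f (fst z, y)) (snd z))"

text \<open>The centred normal distribution with covariance matrix \<open>B\<^sup>-\<^sup>1 = (1 / lam) I\<close>;
  its normalising constant is \<open>sqrt (det B / (2 pi) ^ d)\<close>.\<close>

definition gaussian :: "real \<Rightarrow> 'a::euclidean_space measure" where
  "gaussian lam = density lborel
     (\<lambda>u. ennreal (sqrt (lam ^ DIM('a) / (2 * pi) ^ DIM('a)) * exp (- (B_norm lam u)\<^sup>2 / 2)))"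

definition smoothing :: "real \<Rightarrow> real \<Rightarrow> ('a::euclidean_space \<Rightarrow> real) \<Rightarrow> 'a \<Rightarrow> real" where
  "smoothing lam \<mu> f z = (\<integral>u. f (z + \<mu> *\<^sub>R u) \<partial>gaussian lam)"

definition zo_oracle ::
  "real \<Rightarrow> real \<Rightarrow> ('a::real_vector \<times> 'b::real_vector \<Rightarrow> real) \<Rightarrow> 'a \<times> 'b \<Rightarrow> 'a \<times> 'b \<Rightarrow> 'a \<times> 'b" where
  "zo_oracle lam \<mu> f z u =
     ((f (z + \<mu> *\<^sub>R u) - f z) / \<mu>) *\<^sub>R (lam *\<^sub>R fst u, - (lam *\<^sub>R snd u))"

definition batch_oracle ::
  "real \<Rightarrow> real \<Rightarrow> ('a::real_vector \<times> 'b::real_vector \<Rightarrow> real) \<Rightarrow> nat \<Rightarrow> (nat \<Rightarrow> 'a \<times> 'b)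
     \<Rightarrow> 'a \<times> 'b \<Rightarrow> 'a \<times> 'b" where
  "batch_oracle lam \<mu> f t v z = (1 / real t) *\<^sub>R (\<Sum>i=1..t. zo_oracle lam \<mu> f z (v i))"

text \<open>The iterates as functions of the realised samples: \<open>uhat k i\<close> and \<open>u k i\<close> are the
  \<open>i\<close>-th samples of the first and second batch of iteration \<open>k\<close>, and \<open>t k\<close> is the batch size.\<close>

definition extrapolate ::
  "real \<Rightarrow> real \<Rightarrow> ('a::real_vector \<times> 'b::real_vector \<Rightarrow> real) \<Rightarrow> real \<Rightarrow> (nat \<Rightarrow> nat)
     \<Rightarrow> (nat \<Rightarrow> nat \<Rightarrow> 'a \<times> 'b) \<Rightarrow> nat \<Rightarrow> 'a \<times> 'b \<Rightarrow> 'a \<times> 'b" where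
  "extrapolate lam \<mu> f h1 t uhat k z = z - h1 *\<^sub>R batch_oracle lam \<mu> f (t k) (uhat k) z"

primrec zoeg_z ::
  "real \<Rightarrow> real \<Rightarrow> ('a::real_vector \<times> 'b::real_vector \<Rightarrow> real) \<Rightarrow> real \<Rightarrow> real \<Rightarrow> (nat \<Rightarrow> nat)
     \<Rightarrow> (nat \<Rightarrow> nat \<Rightarrow> 'a \<times> 'b) \<Rightarrow> (nat \<Rightarrow> nat \<Rightarrow> 'a \<times> 'b) \<Rightarrow> 'a \<times> 'b \<Rightarrow> nat \<Rightarrow> 'a \<times> 'b" where
  "zoeg_z lam \<mu> f h1 h2 t uhat u z0 0 = z0"
| "zoeg_z lam \<mu> f h1 h2 t uhat u z0 (Suc k) =
     (let z = zoeg_z lam \<mu> f h1 h2 t uhat u z0 k;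
          zhat = extrapolate lam \<mu> f h1 t uhat k z
      in z - h2 *\<^sub>R batch_oracle lam \<mu> f (t k) (u k) zhat)"

definition zoeg_zhat ::
  "real \<Rightarrow> real \<Rightarrow> ('a::real_vector \<times> 'b::real_vector \<Rightarrow> real) \<Rightarrow> real \<Rightarrow> real \<Rightarrow> (nat \<Rightarrow> nat)
     \<Rightarrow> (nat \<Rightarrow> nat \<Rightarrow> 'a \<times> 'b) \<Rightarrow> (nat \<Rightarrow> nat \<Rightarrow> 'a \<times> 'b) \<Rightarrow> 'a \<times> 'b \<Rightarrow> nat \<Rightarrow> 'a \<times> 'b" where
  "zoeg_zhat lam \<mu> f h1 h2 t uhat u z0 k =
     extrapolate lam \<mu> f h1 t uhat k (zoeg_z lam \<mu> f h1 h2 t uhat u z0 k)"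

end

theory Submission
  imports Defs
begin

text \<open>By Gaussian integration by parts the oracle \<open>G\<^sub>\<mu>(z; u)\<close> has mean \<open>\<Phi>(z) = E F(z + \<mu> u)\<close>,
  and since the mean minimises the second moment about a point, the variance hypothesis about
  \<open>F\<^sub>\<mu>\<close> bounds the variance about \<open>\<Phi>\<close>.
  The map \<open>\<Phi>\<close> inherits the Lipschitz constant \<open>\<lambda> L\<^sub>1\<close> and satisfies the weak Minty inequality up to
  \<open>O(\<mu>\<^sup>2 L\<^sub>1 d)\<close>. Write \<open>A = \<Phi>(z) + e\<close> for the first batch average and \<open>y = z - h\<^sub>1 A\<close>. As \<open>h\<^sub>1 \<lambda> L\<^sub>1 \<le> 1\<close>,
  the term \<open>|\<Phi>(y) - \<Phi>(z)|\<^sup>2\<close> is absorbed by \<open>|A|\<^sup>2\<close>, and the cross term \<open>\<langle>\<Phi>(y), e\<rangle>\<close> is compared with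
  \<open>\<langle>\<Phi>(z - h\<^sub>1 \<Phi>(z)), e\<rangle>\<close>, which has mean zero. Hence the expected squared distance to \<open>z\<^sup>*\<close> drops in
  every step by a multiple of \<open>E |\<Phi>(y)|\<^sup>2\<close> up to the noise; the sum over the steps telescopes.\<close>

subsection \<open>Gaussian integration by parts\<close>

text \<open>No second moment of the iterates is available in advance. The expected steps are
  therefore inequalities between integrals of nonnegative functions in \<open>ennreal\<close>, and
  integrability over the sample space is read off at the end from a finite total. Conditional
  expectation is replaced by Fubini for pairs (older samples, fresh batch): with the older samples
  frozen, the evaluation point is constant, and the moments of a batch at a fixed point apply.

  The noise \<open>e\<close> enters \<Phi>(y) nonlinearly, so <\<Phi>(y), e> need not have mean
  zero. The point z - h1 \<Phi>(z) is the noiseless extrapolation, fixed once z is, and replacing it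
  by y costs only a multiple of |e|^2.

  All estimates are Euclidean. The decrease of one step has the coefficient h1 h2 - h2^2 - h2 \<rho>
  / lam, which is at least 3/4 h2^2 and at least 3/8 h1 h2; the first bound pays for the initial
  distance and the smoothing bias, the second for the sampling noise.\<close>

lemma B_norm_eq: "lam \<ge> 0 \<Longrightarrow> B_norm lam z = sqrt lam * norm z"
  by (simp add: B_norm_def real_sqrt_mult norm_eq_sqrt_inner)

lemma B_dual_norm_eq: "B_dual_norm lam z = norm z / sqrt lam"
  by (simp add: B_dual_norm_def real_sqrt_divide norm_eq_sqrt_inner)

text \<open>Serves the computation of the total mass: the integral of a product over coordinates is
  a product of one-dimensional integrals, each equal to 1.\<close>

lemma gaussian_eq_prod_normal_density:
  assumes "lam > 0"
  shows "(gaussian lam :: 'a::euclidean_space measure) =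
    density lborel (\<lambda>u. ennreal (\<Prod>b\<in>Basis. normal_density 0 (1 / sqrt lam) (u \<bullet> b)))"
proof -
  have "sqrt (lam ^ DIM('a) / (2 * pi) ^ DIM('a)) * exp (- (B_norm lam u)\<^sup>2 / 2)
      = (\<Prod>b\<in>Basis. normal_density 0 (1 / sqrt lam) (u \<bullet> b))" for u :: 'a
  proof -
    have "(norm u)\<^sup>2 = (\<Sum>b\<in>Basis. (u \<bullet> b)\<^sup>2)"
      unfolding power2_norm_eq_inner by (subst euclidean_inner) (simp add: power2_eq_square)
    then have "(\<Prod>b\<in>Basis. exp (- (lam * (u \<bullet> b)\<^sup>2) / 2)) = exp (- (B_norm lam u)\<^sup>2 / 2)"
      using assms
      by (simp add: exp_sum[symmetric] B_norm_eq power_mult_distrib sum_distrib_left sum_negf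
          sum_divide_distrib)
    moreover have "sqrt (lam ^ DIM('a) / (2 * pi) ^ DIM('a)) = (1 / sqrt (2 * pi / lam)) ^ DIM('a)"
      using assms by (simp add: real_sqrt_divide real_sqrt_mult real_sqrt_power power_divide
          power_mult_distrib)
    ultimately show ?thesis
      using assms by (simp add: normal_density_def prod_dividef power_divide mult.commute)
  qed
  then show ?thesis
    by (simp add: gaussian_def)
qed

lemma prob_space_gaussian:
  assumes "lam > 0"
  shows "prob_space (gaussian lam :: 'a::euclidean_space measure)"
proof
  interpret normal: prob_space "density lborel (\<lambda>x::real. ennreal (normal_density 0 (1 / sqrt lam) x))"
    using assms by (intro prob_space_normal_density) simp
  have "(\<integral>\<^sup>+x. ennreal (normal_density 0 (1 / sqrt lam) x) \<partial>lborel) = 1"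
    using normal.emeasure_space_1 by (simp add: emeasure_density)
  then show "emeasure (gaussian lam :: 'a measure) (space (gaussian lam)) = 1"
    using assms nn_integral_lborel_prod[of "\<lambda>_::'a. normal_density 0 (1 / sqrt lam)"]
    by (simp add: gaussian_eq_prod_normal_density emeasure_density prod_ennreal)
qed

lemma sets_gaussian [measurable_cong, simp]: "sets (gaussian lam) = sets borel"
  by (simp add: gaussian_def)

lemma space_gaussian [simp]: "space (gaussian lam) = UNIV"
  by (simp add: gaussian_def)

lemma gaussian_eq_density:
  assumes "lam \<ge> 0"
  shows "(gaussian lam :: 'a::euclidean_space measure) = density lborel (\<lambda>u. ennreal
    (sqrt (lam ^ DIM('a) / (2 * pi) ^ DIM('a)) * exp (- (lam / 2 * (norm u)\<^sup>2))))"
  using assms by (simp add: gaussian_def B_norm_eq power_mult_distrib)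

lemma integrable_gaussian_iff:
  fixes f :: "'a::euclidean_space \<Rightarrow> 'b::{banach, second_countable_topology}"
  assumes "lam > 0" "f \<in> borel_measurable borel"
  shows "integrable (gaussian lam) f \<longleftrightarrow>
    integrable lborel (\<lambda>u. exp (- (lam / 2 * (norm u)\<^sup>2)) *\<^sub>R f u)"
proof -
  define c where "c = sqrt (lam ^ DIM('a) / (2 * pi) ^ DIM('a))"
  let ?g = "\<lambda>u. exp (- (lam / 2 * (norm u)\<^sup>2)) *\<^sub>R f u"
  have "c > 0"
    using assms by (simp add: c_def)
  have "integrable (gaussian lam) f \<longleftrightarrow> integrable lborel (\<lambda>u. c *\<^sub>R ?g u)"
    using assms \<open>c > 0\<close>
    by (simp add: gaussian_eq_density integrable_density mult_nonneg_nonneg c_def)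
  also have "\<dots> \<longleftrightarrow> integrable lborel ?g"
    using integrable_scaleR_right[of "1 / c" lborel "\<lambda>u. c *\<^sub>R ?g u"]
      integrable_scaleR_right[of c lborel ?g] \<open>c > 0\<close> by auto
  finally show ?thesis .
qed

lemma integral_gaussian:
  fixes f :: "'a::euclidean_space \<Rightarrow> 'b::{banach, second_countable_topology}"
  assumes "lam > 0" "f \<in> borel_measurable borel"
  shows "(\<integral>u. f u \<partial>gaussian lam) = sqrt (lam ^ DIM('a) / (2 * pi) ^ DIM('a)) *\<^sub>R
    (\<integral>u. exp (- (lam / 2 * (norm u)\<^sup>2)) *\<^sub>R f u \<partial>lborel)"
  using assms
  by (simp add: gaussian_eq_density integral_density mult_nonneg_nonneg flip: scaleR_scaleR)

text \<open>Up to a constant the integrand is the density of \<open>gaussian (2 * c)\<close>, a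
  probability measure, under which the constant 1 is integrable.\<close>

lemma integrable_exp_norm_sq:
  assumes "c > 0"
  shows "integrable lborel (\<lambda>u::'a::euclidean_space. exp (- (c * (norm u)\<^sup>2)))"
proof -
  interpret prob_space "gaussian (2 * c) :: 'a measure"
    using assms by (simp add: prob_space_gaussian)
  have "integrable (gaussian (2 * c)) (\<lambda>_::'a. 1 :: real)"
    by simp
  then show ?thesis
    using assms by (subst (asm) integrable_gaussian_iff) auto
qed

text \<open>Half of the Gaussian exponent pays for the polynomial: 1 + r <= exp r, and k r <= k^2 /
  (2 c) + (c / 2) r^2 by completing the square.\<close>

lemma integrable_poly_exp_norm_sq:
  assumes "c > 0"
  shows "integrable lborel (\<lambda>u::'a::euclidean_space. (1 + norm u) ^ k * exp (- (c * (norm u)\<^sup>2)))"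
proof (rule Bochner_Integration.integrable_bound)
  show "integrable lborel (\<lambda>u::'a. exp ((real k)\<^sup>2 / (2 * c)) * exp (- (c / 2 * (norm u)\<^sup>2)))"
    using integrable_exp_norm_sq[of "c / 2"] assms by simp
  have "(1 + r) ^ k * exp (- (c * r\<^sup>2)) \<le> exp ((real k)\<^sup>2 / (2 * c)) * exp (- (c / 2 * r\<^sup>2))"
    if "r \<ge> 0" for r :: real
  proof -
    have "(1 + r) ^ k \<le> exp r ^ k"
      using that by (intro power_mono) auto
    also have "\<dots> = exp (real k * r)"
      by (simp add: exp_of_nat_mult)
    also have "\<dots> \<le> exp ((real k)\<^sup>2 / (2 * c) + c / 2 * r\<^sup>2)"
    proof -
      have "0 \<le> (real k - c * r)\<^sup>2 / (2 * c)"
        using assms by simp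
      also have "\<dots> = (real k)\<^sup>2 / (2 * c) + c / 2 * r\<^sup>2 - real k * r"
        using assms by (simp add: field_simps power2_eq_square)
      finally show ?thesis by simp
    qed
    finally have "(1 + r) ^ k * exp (- (c * r\<^sup>2))
        \<le> exp ((real k)\<^sup>2 / (2 * c) + c / 2 * r\<^sup>2) * exp (- (c * r\<^sup>2))"
      by (intro mult_right_mono) auto
    also have "\<dots> = exp ((real k)\<^sup>2 / (2 * c)) * exp (- (c / 2 * r\<^sup>2))"
      by (simp add: field_simps flip: exp_add)
    finally show ?thesis .
  qed
  then show "AE u in lborel. norm ((1 + norm u) ^ k * exp (- (c * (norm (u::'a))\<^sup>2)))
      \<le> norm (exp ((real k)\<^sup>2 / (2 * c)) * exp (- (c / 2 * (norm u)\<^sup>2)))"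
    by (intro AE_I2) simp
qed simp

lemma integrable_gaussian_poly_growth:
  fixes f :: "'a::euclidean_space \<Rightarrow> 'b::{banach, second_countable_topology}"
  assumes "lam > 0" and [measurable]: "f \<in> borel_measurable borel"
    and bound: "\<And>u. norm (f u) \<le> C * (1 + norm u) ^ k"
  shows "integrable (gaussian lam) f"
proof (rule Bochner_Integration.integrable_bound)
  show "integrable (gaussian lam) (\<lambda>u::'a. C * (1 + norm u) ^ k)"
    using integrable_poly_exp_norm_sq[of "lam / 2" k, where 'a = 'a] assms(1)
    by (intro integrable_mult_right) (simp add: integrable_gaussian_iff mult.commute)
  show "AE u in gaussian lam. norm (f u) \<le> norm (C * (1 + norm u) ^ k)"
    using bound by (intro AE_I2) (smt (verit) real_norm_def)
  show "f \<in> borel_measurable (gaussian lam)"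
    by measurable
qed

text \<open>By translation invariance every difference quotient has integral zero; dominated
  convergence passes this on to the derivative.\<close>

lemma integral_directional_derivative_eq_0:
  fixes g :: "'a::euclidean_space \<Rightarrow> real"
  assumes deriv: "\<And>u. (g has_derivative D u) (at u)"
    and int: "integrable lborel g" "integrable lborel w"
    and D_meas: "(\<lambda>u. D u b) \<in> borel_measurable borel"
    and bound: "\<And>u s. \<bar>s\<bar> \<le> 1 \<Longrightarrow> \<bar>D (u + s *\<^sub>R b) b\<bar> \<le> w u"
  shows "(\<integral>u. D u b \<partial>lborel) = 0"
proof -
  \<comment> \<open>The sequence stays in (0, 1], the range of shifts for which \<open>w\<close>
    dominates.\<close>
  define X :: "nat \<Rightarrow> real" where "X n = 1 / real (Suc n)" for n
  have X: "X n > 0" "X n \<le> 1" for n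
    by (auto simp: X_def)
  have X_tendsto: "filterlim X (at 0) sequentially"
    unfolding X_def
    by (intro filterlim_atI LIMSEQ_Suc[OF lim_1_over_n]) (auto simp: X_def)
  have line: "((\<lambda>s. g (u + s *\<^sub>R b)) has_real_derivative D (u + s *\<^sub>R b) b) (at s)" for u s
  proof -
    interpret D: linear "D (u + s *\<^sub>R b)"
      using deriv has_derivative_linear by blast
    have "((\<lambda>s. g (u + s *\<^sub>R b)) has_derivative (\<lambda>x. D (u + s *\<^sub>R b) (x *\<^sub>R b))) (at s)"
      by (rule has_derivative_compose[of "\<lambda>s. u + s *\<^sub>R b", OF _ deriv])
        (auto intro!: derivative_eq_intros)
    moreover have "(\<lambda>x. D (u + s *\<^sub>R b) (x *\<^sub>R b)) = (*) (D (u + s *\<^sub>R b) b)"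
      by (auto simp: D.scaleR)
    ultimately show ?thesis
      unfolding has_field_derivative_def by simp
  qed
  define q where "q n u = (g (u + X n *\<^sub>R b) - g u) / X n" for n u
  have g_meas [measurable]: "g \<in> borel_measurable borel"
    using int by simp
  \<comment> \<open>By the mean value theorem the quotient is the directional derivative at an
    intermediate shift of size at most 1, where the domination hypothesis applies.\<close>
  have q_bound: "\<bar>q n u\<bar> \<le> w u" for n u
  proof -
    obtain s where "0 < s" "s < X n" "g (u + X n *\<^sub>R b) - g u = X n * D (u + s *\<^sub>R b) b"
      using MVT2[of 0 "X n" "\<lambda>s. g (u + s *\<^sub>R b)" "\<lambda>s. D (u + s *\<^sub>R b) b"] line X(1) by auto
    then show ?thesis
      using bound[of s u] X[of n] by (simp add: q_def)
  qed
  have "(\<lambda>n. \<integral>u. q n u \<partial>lborel) \<longlonglongrightarrow> (\<integral>u. D u b \<partial>lborel)"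
  proof (rule integral_dominated_convergence[where w = w])
    show "AE u in lborel. (\<lambda>n. q n u) \<longlonglongrightarrow> D u b"
    proof (rule AE_I2)
      fix u
      have "((\<lambda>s. (g (u + s *\<^sub>R b) - g u) / s) \<longlongrightarrow> D u b) (at 0)"
        using line[of u 0] by (simp add: DERIV_def)
      from filterlim_compose[OF this X_tendsto] show "(\<lambda>n. q n u) \<longlonglongrightarrow> D u b"
        by (simp add: q_def)
    qed
    show "(\<lambda>u. D u b) \<in> borel_measurable lborel"
      using D_meas by simp
    show "q n \<in> borel_measurable lborel" for n
      unfolding q_def by measurable
  qed (use q_bound int in auto)
  moreover have "(\<integral>u. q n u \<partial>lborel) = 0" for n
  proof -
    have distr: "lborel = distr lborel borel ((+) (X n *\<^sub>R b))"
      by (simp add: lborel_distr_plus)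
    have int_shift: "integrable lborel (\<lambda>u. g (X n *\<^sub>R b + u))"
      using int(1) by (subst (asm) distr, subst (asm) integrable_distr_eq) auto
    have "(\<integral>u. g (X n *\<^sub>R b + u) \<partial>lborel) = (\<integral>u. g u \<partial>lborel)"
      by (subst (2) distr, subst integral_distr) auto
    then show ?thesis
      using int(1) int_shift unfolding q_def by (simp add: add.commute)
  qed
  ultimately show ?thesis
    by (simp add: LIMSEQ_const_iff)
qed

text \<open>Stein's identity. The derivative along \<open>b\<close> of the weight times
  \<open>\<phi>\<close> is the weight times
  \<open>b \<bullet> g u - lam * (u \<bullet> b) * \<phi> u\<close>, and its integral is zero; the
  polynomial growth bounds make the integrals converge.\<close>

lemma gaussian_integration_by_parts:
  fixes \<phi> :: "'a::euclidean_space \<Rightarrow> real"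
  assumes lam: "lam > 0"
    and deriv: "\<And>u. GDERIV \<phi> u :> g u"
    and g_meas [measurable]: "g \<in> borel_measurable borel"
    and growth: "\<And>u. \<bar>\<phi> u\<bar> \<le> C * (1 + norm u) ^ k" "\<And>u. norm (g u) \<le> C * (1 + norm u) ^ k"
  shows "lam *\<^sub>R (\<integral>u. \<phi> u *\<^sub>R u \<partial>gaussian lam) = (\<integral>u. g u \<partial>gaussian lam)"
proof (rule euclidean_eqI)
  fix b :: 'a assume b: "b \<in> Basis"
  define p where "p u = exp (- (lam / 2 * (norm u)\<^sup>2))" for u :: 'a
  have deriv': "(\<phi> has_derivative (\<lambda>h. h \<bullet> g u)) (at u)" for u
    using deriv by (simp add: gderiv_def)
  have [measurable]: "\<phi> \<in> borel_measurable borel"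
    using deriv' by (intro borel_measurable_continuous_onI)
      (meson continuous_at_imp_continuous_on has_derivative_continuous)
  have C: "C \<ge> 0"
    using growth(1)[of 0] by simp
  define D where "D u h = p u * (h \<bullet> g u - lam * (u \<bullet> h) * \<phi> u)" for u h
  have p_deriv: "(p has_derivative (\<lambda>h. - (lam * (u \<bullet> h)) * p u)) (at u)" for u
    unfolding p_def power2_norm_eq_inner
    by (auto intro!: derivative_eq_intros simp: algebra_simps inner_commute)
  have D_deriv: "((\<lambda>u. p u * \<phi> u) has_derivative D u) (at u)" for u
    unfolding D_def using has_derivative_mult[OF p_deriv deriv']
    by (simp add: algebra_simps)
  have int1: "integrable (gaussian lam) (\<lambda>u. g u \<bullet> b)"
    by (rule integrable_gaussian_poly_growth[OF lam, where C = C and k = k])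
      (use order_trans[OF Basis_le_norm[OF b] growth(2)] in auto)
  have int2: "integrable (gaussian lam) (\<lambda>u. \<phi> u *\<^sub>R u)"
  proof (rule integrable_gaussian_poly_growth[OF lam, where C = C and k = "Suc k"])
    fix u :: 'a
    have "\<bar>\<phi> u\<bar> * norm u \<le> (C * (1 + norm u) ^ k) * (1 + norm u)"
      using growth(1)[of u] C by (intro mult_mono) auto
    then show "norm (\<phi> u *\<^sub>R u) \<le> C * (1 + norm u) ^ Suc k"
      by (simp add: mult_ac)
  qed measurable
  have int2': "integrable (gaussian lam) (\<lambda>u. lam * (u \<bullet> b) * \<phi> u)"
    using integrable_mult_right[OF integrable_inner_left[OF int2, of b], of lam]
    by (simp add: mult_ac)
  have "integrable (gaussian lam) \<phi>"
    by (rule integrable_gaussian_poly_growth[OF lam, where C = C and k = k])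
      (use growth in auto)
  then have int3: "integrable lborel (\<lambda>u. p u * \<phi> u)"
    using lam by (simp add: integrable_gaussian_iff p_def)
  \<comment> \<open>Domination uniform in the shift. For v = u + s b the polynomial grows by at most
    2 ^ (k + 1), and |u|^2 <= 2 |v|^2 + 2 keeps half of the exponent at the price of the factor exp
    (lam / 2).\<close>
  have bound: "\<bar>D (u + s *\<^sub>R b) b\<bar> \<le> (C * (1 + lam) * 2 ^ Suc k * exp (lam / 2)) *
      ((1 + norm u) ^ Suc k * exp (- (lam / 4 * (norm u)\<^sup>2)))" if s: "\<bar>s\<bar> \<le> 1" for u s
  proof -
    define v where "v = u + s *\<^sub>R b"
    have nv: "norm v \<le> norm u + 1" "norm u \<le> norm v + 1"
      using norm_triangle_ineq[of u "s *\<^sub>R b"] norm_triangle_ineq4[of v "s *\<^sub>R b"] s b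
      by (auto simp: v_def)
    have "\<bar>b \<bullet> g v - lam * (v \<bullet> b) * \<phi> v\<bar> \<le> \<bar>g v \<bullet> b\<bar> + lam * (\<bar>v \<bullet> b\<bar> * \<bar>\<phi> v\<bar>)"
      using lam abs_triangle_ineq4[of "b \<bullet> g v" "lam * (v \<bullet> b) * \<phi> v"]
      by (simp add: abs_mult inner_commute)
    also have "\<dots> \<le> C * (1 + norm v) ^ k + lam * ((1 + norm v) * (C * (1 + norm v) ^ k))"
      using growth[of v] Basis_le_norm[OF b, of v] Basis_le_norm[OF b, of "g v"] lam C
      by (intro add_mono mult_left_mono mult_mono) (auto intro: order_trans)
    also have "\<dots> \<le> C * (1 + norm v) ^ Suc k + lam * (C * (1 + norm v) ^ Suc k)"
      using C by (intro add_mono mult_left_mono power_increasing)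
        (use lam in \<open>auto simp: mult_ac\<close>)
    also have "\<dots> = C * (1 + lam) * (1 + norm v) ^ Suc k"
      by (simp add: algebra_simps)
    also have "\<dots> \<le> C * (1 + lam) * (2 * (1 + norm u)) ^ Suc k"
    proof -
      have "1 + norm v \<le> 2 * (1 + norm u)"
        using nv(1) norm_ge_zero[of u] by argo
      then show ?thesis
        using C lam by (intro mult_left_mono power_mono) auto
    qed
    finally have 1: "\<bar>b \<bullet> g v - lam * (v \<bullet> b) * \<phi> v\<bar> \<le> C * (1 + lam) * (2 * (1 + norm u)) ^ Suc k" .
    have "(norm u)\<^sup>2 \<le> (norm v + 1)\<^sup>2"
      using nv by (intro power_mono) auto
    also have "\<dots> \<le> 2 * (norm v)\<^sup>2 + 2"
      using sum_squares_bound[of "norm v" 1] by (simp add: power2_eq_square algebra_simps)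
    finally have "lam / 4 * (norm u)\<^sup>2 \<le> lam / 4 * (2 * (norm v)\<^sup>2 + 2)"
      using lam by (intro mult_left_mono) auto
    then have "- (lam / 2 * (norm v)\<^sup>2) \<le> lam / 2 + - (lam / 4 * (norm u)\<^sup>2)"
      by (simp add: algebra_simps)
    then have 2: "p v \<le> exp (lam / 2) * exp (- (lam / 4 * (norm u)\<^sup>2))"
      unfolding p_def by (simp flip: exp_add)
    have "\<bar>D v b\<bar> = p v * \<bar>b \<bullet> g v - lam * (v \<bullet> b) * \<phi> v\<bar>"
      by (simp add: D_def abs_mult p_def)
    also have "\<dots> \<le> (exp (lam / 2) * exp (- (lam / 4 * (norm u)\<^sup>2))) *
        (C * (1 + lam) * (2 * (1 + norm u)) ^ Suc k)"
      by (rule mult_mono[OF 2 1]) auto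
    finally show ?thesis
      unfolding v_def power_mult_distrib by (simp only: mult_ac)
  qed
  have "(\<integral>u. D u b \<partial>lborel) = 0"
  proof (rule integral_directional_derivative_eq_0[OF D_deriv int3 _ _ bound])
    show "integrable lborel (\<lambda>u::'a. (C * (1 + lam) * 2 ^ Suc k * exp (lam / 2)) *
      ((1 + norm u) ^ Suc k * exp (- (lam / 4 * (norm u)\<^sup>2))))"
      using lam by (intro integrable_mult_right integrable_poly_exp_norm_sq) auto
    show "(\<lambda>u. D u b) \<in> borel_measurable borel"
      unfolding D_def p_def by measurable
  qed
  then have "(\<integral>u. g u \<bullet> b - lam * (u \<bullet> b) * \<phi> u \<partial>gaussian lam) = 0"
    using lam by (subst integral_gaussian) (auto simp: D_def p_def inner_commute)
  then have "(\<integral>u. g u \<bullet> b \<partial>gaussian lam) = (\<integral>u. lam * (u \<bullet> b) * \<phi> u \<partial>gaussian lam)"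
    using int1 int2' by simp
  also have "\<dots> = lam * (\<integral>u. (\<phi> u *\<^sub>R u) \<bullet> b \<partial>gaussian lam)"
    by (simp add: mult_ac flip: integral_mult_right_zero)
  finally have "(\<integral>u. g u \<bullet> b \<partial>gaussian lam) = lam * ((\<integral>u. \<phi> u *\<^sub>R u \<partial>gaussian lam) \<bullet> b)"
    using integral_inner_left[OF int2, of b] by simp
  moreover have "integrable (gaussian lam) g"
    by (rule integrable_gaussian_poly_growth[OF lam, where C = C and k = k])
      (use growth in auto)
  ultimately show "(lam *\<^sub>R (\<integral>u. \<phi> u *\<^sub>R u \<partial>gaussian lam)) \<bullet> b = (\<integral>u. g u \<partial>gaussian lam) \<bullet> b"
    by simp
qed

text \<open>Integration by parts against the constant 1, whose gradient vanishes.\<close>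

lemma gaussian_mean: "lam > 0 \<Longrightarrow> (\<integral>u. u \<partial>gaussian lam) = (0 :: 'a::euclidean_space)"
  using gaussian_integration_by_parts[of lam "\<lambda>_. 1" "\<lambda>_. 0 :: 'a" 1 0]
  by (simp add: GDERIV_const)

lemma integrable_gaussian_norm_sq:
  "lam > 0 \<Longrightarrow> integrable (gaussian lam) (\<lambda>u::'a::euclidean_space. (norm u)\<^sup>2)"
  by (rule integrable_gaussian_poly_growth[where C = 1 and k = 2]) (auto intro!: power_mono)

text \<open>Integration by parts with \<open>\<phi> u = u \<bullet> b\<close>, whose gradient is the
  constant \<open>b\<close>, gives the variance 1 / lam in each coordinate.\<close>

lemma gaussian_second_moment:
  assumes lam: "lam > 0"
  shows "(\<integral>u. (norm (u::'a::euclidean_space))\<^sup>2 \<partial>gaussian lam) = DIM('a) / lam"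
proof -
  interpret prob_space "gaussian lam :: 'a measure"
    using lam by (rule prob_space_gaussian)
  have coord: "integrable (gaussian lam) (\<lambda>u. (u \<bullet> b)\<^sup>2)" "(\<integral>u. (u \<bullet> b)\<^sup>2 \<partial>gaussian lam) = 1 / lam"
    if b: "b \<in> Basis" for b :: 'a
  proof -
    have le: "\<bar>u \<bullet> b\<bar> \<le> 1 * (1 + norm u) ^ 1" for u :: 'a
      using add_increasing[OF zero_le_one Basis_le_norm[OF b, of u]]
      by (simp only: mult_1 power_one_right)
    have int: "integrable (gaussian lam) (\<lambda>u. (u \<bullet> b) *\<^sub>R u)"
    proof (rule integrable_gaussian_poly_growth[OF lam, where C = 1 and k = 2])
      fix u :: 'a
      have "\<bar>u \<bullet> b\<bar> * norm u \<le> (1 + norm u) * (1 + norm u)"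
        using le[of u] by (intro mult_mono) simp_all
      then show "norm ((u \<bullet> b) *\<^sub>R u) \<le> 1 * (1 + norm u)\<^sup>2"
        by (simp only: norm_scaleR power2_eq_square mult_1)
    qed measurable
    have "GDERIV (\<lambda>u. u \<bullet> b) u :> b" for u
      unfolding gderiv_def by (auto intro!: derivative_eq_intros)
    moreover have "norm b \<le> 1 * (1 + norm u) ^ 1" for u :: 'a
      using b by simp
    ultimately have "lam *\<^sub>R (\<integral>u. (u \<bullet> b) *\<^sub>R u \<partial>gaussian lam) = (\<integral>u. b \<partial>(gaussian lam :: 'a measure))"
      using le by (intro gaussian_integration_by_parts[OF lam, where C = 1 and k = 1]) simp_all
    also have "\<dots> = b"
      using prob_space by simp
    finally have "(lam *\<^sub>R (\<integral>u. (u \<bullet> b) *\<^sub>R u \<partial>gaussian lam)) \<bullet> b = 1"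
      using b by simp
    then have "(\<integral>u. ((u \<bullet> b) *\<^sub>R u) \<bullet> b \<partial>gaussian lam) = 1 / lam"
      unfolding integral_inner_left[OF int] using lam by (simp add: field_simps)
    then show "(\<integral>u. (u \<bullet> b)\<^sup>2 \<partial>gaussian lam) = 1 / lam"
      by (simp only: power2_eq_square inner_scaleR_left)
    show "integrable (gaussian lam) (\<lambda>u. (u \<bullet> b)\<^sup>2)"
      using integrable_inner_left[OF int, of b] by (simp only: power2_eq_square inner_scaleR_left)
  qed
  have "(\<integral>u. (norm (u::'a))\<^sup>2 \<partial>gaussian lam) = (\<integral>u. (\<Sum>b\<in>Basis. (u \<bullet> b)\<^sup>2) \<partial>(gaussian lam :: 'a measure))"
    unfolding power2_norm_eq_inner by (subst euclidean_inner) (simp only: power2_eq_square)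
  also have "\<dots> = (\<Sum>b\<in>Basis. (\<integral>u. (u \<bullet> b)\<^sup>2 \<partial>(gaussian lam :: 'a measure)))"
    using coord by (intro Bochner_Integration.integral_sum) simp
  also have "\<dots> = (\<Sum>b\<in>(Basis::'a set). 1 / lam)"
    using coord by (intro sum.cong) simp_all
  finally show ?thesis
    by simp
qed

text \<open>Bias-variance decomposition about an arbitrary centre. Dropping the variance bounds the
  distance of the mean from \<open>c\<close>; dropping the bias shows that the mean is the best
  centre.\<close>

lemma (in prob_space)
  fixes X :: "'a \<Rightarrow> 'b::euclidean_space"
  assumes X [measurable]: "X \<in> borel_measurable M" and sq: "integrable M (\<lambda>\<omega>. (norm (X \<omega>))\<^sup>2)"
  shows integrable_of_norm_sq: "integrable M X"
    and integrable_norm_sq_diff: "integrable M (\<lambda>\<omega>. (norm (X \<omega> - c))\<^sup>2)"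
    and expectation_norm_sq_diff:
      "expectation (\<lambda>\<omega>. (norm (X \<omega> - c))\<^sup>2) =
        (norm (expectation X - c))\<^sup>2 + expectation (\<lambda>\<omega>. (norm (X \<omega> - expectation X))\<^sup>2)"
proof -
  show int: "integrable M X"
    using square_integrable_imp_integrable[of "\<lambda>\<omega>. norm (X \<omega>)"] sq
    by (simp add: integrable_norm_iff)
  have expand: "(norm (X \<omega> - a))\<^sup>2 = (norm (X \<omega>))\<^sup>2 - 2 * (X \<omega> \<bullet> a) + (norm a)\<^sup>2" for \<omega> a
    by (simp add: power2_norm_eq_inner inner_diff_left inner_diff_right inner_commute)
  show "integrable M (\<lambda>\<omega>. (norm (X \<omega> - c))\<^sup>2)"
    unfolding expand using int sq by simp
  have E: "expectation (\<lambda>\<omega>. (norm (X \<omega> - a))\<^sup>2) =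
      expectation (\<lambda>\<omega>. (norm (X \<omega>))\<^sup>2) - 2 * (expectation X \<bullet> a) + (norm a)\<^sup>2" for a
    unfolding expand using int sq by (simp add: prob_space)
  show "expectation (\<lambda>\<omega>. (norm (X \<omega> - c))\<^sup>2) =
        (norm (expectation X - c))\<^sup>2 + expectation (\<lambda>\<omega>. (norm (X \<omega> - expectation X))\<^sup>2)"
    unfolding E
    by (simp add: power2_norm_eq_inner inner_diff_left inner_diff_right inner_commute)
qed

subsection \<open>The mean of the oracle\<close>

lemma GDERIV_unique:
  assumes "GDERIV f z :> D" "GDERIV f z :> D'"
  shows "D = D'"
proof -
  have "(\<lambda>h. h \<bullet> D) = (\<lambda>h. h \<bullet> D')"
    using assms unfolding gderiv_def by (rule has_derivative_unique)
  then show ?thesis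
    by (simp only: fun_eq_iff vector_eq_ldot)
qed

lemma grad_eqI: "GDERIV f z :> D \<Longrightarrow> grad f z = D"
  unfolding grad_def using GDERIV_unique by blast

text \<open>The definite description in \<open>grad\<close> needs a witness: the Riesz vector of the
  derivative, assembled from its values on \<open>Basis\<close>.\<close>

lemma GDERIV_grad:
  fixes f :: "'a::euclidean_space \<Rightarrow> real"
  assumes "f differentiable (at z)"
  shows "GDERIV f z :> grad f z"
proof -
  obtain D where D: "(f has_derivative D) (at z)"
    using assms by (auto simp: differentiable_def)
  interpret D: linear D
    using D by (rule has_derivative_linear)
  have D_eq: "D h = h \<bullet> (\<Sum>b\<in>Basis. D b *\<^sub>R b)" for h
  proof -
    have "D h = D (\<Sum>b\<in>Basis. (h \<bullet> b) *\<^sub>R b)"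
      by (simp only: euclidean_representation)
    also have "\<dots> = h \<bullet> (\<Sum>b\<in>Basis. D b *\<^sub>R b)"
      by (simp only: D.sum D.scaleR inner_sum_right inner_scaleR_right real_scaleR_def mult.commute)
    finally show ?thesis .
  qed
  have "GDERIV f z :> (\<Sum>b\<in>Basis. D b *\<^sub>R b)"
    unfolding gderiv_def using D_eq by (intro has_derivative_eq_rhs[OF D]) (rule ext)
  then show ?thesis
    by (simp only: grad_eqI)
qed

text \<open>The sign change that turns a gradient into a saddle operator, isolated as a linear
  isometry so that norm bounds and integrals pass from \<open>grad f\<close> to
  \<open>saddle_op f\<close>.\<close>

definition flip_snd :: "'a::real_vector \<times> 'b::real_vector \<Rightarrow> 'a \<times> 'b" where
  "flip_snd p = (fst p, - snd p)"

lemma bounded_linear_flip_snd: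
  "bounded_linear (flip_snd :: 'a::real_normed_vector \<times> 'b::real_normed_vector \<Rightarrow> 'a \<times> 'b)"
  unfolding flip_snd_def
  by (intro bounded_linear_Pair bounded_linear_fst bounded_linear_minus bounded_linear_snd)

lemma norm_flip_snd [simp]: "norm (flip_snd p) = norm p"
  by (simp add: flip_snd_def norm_prod_def)

lemma flip_snd_measurable [measurable]:
  "(flip_snd :: 'a::euclidean_space \<times> 'b::euclidean_space \<Rightarrow> 'a \<times> 'b) \<in> borel_measurable borel"
  by (intro borel_measurable_continuous_onI linear_continuous_on bounded_linear_flip_snd)

lemma flip_snd_diff: "flip_snd (p - q) = flip_snd p - flip_snd q"
  by (simp add: flip_snd_def minus_prod_def)

lemma saddle_op_eq_grad:
  fixes f :: "'a::euclidean_space \<times> 'b::euclidean_space \<Rightarrow> real"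
  assumes "f differentiable (at z)"
  shows "saddle_op f z = flip_snd (grad f z)"
proof -
  have f: "(f has_derivative (\<lambda>h. h \<bullet> grad f z)) (at (fst z, snd z))"
    using GDERIV_grad[OF assms] by (simp add: gderiv_def)
  have "((\<lambda>x. f (x, snd z)) has_derivative (\<lambda>h. (h, 0) \<bullet> grad f z)) (at (fst z))"
    by (rule has_derivative_compose[of "\<lambda>x. (x, snd z)", OF _ f])
      (auto intro!: derivative_eq_intros)
  then have 1: "grad (\<lambda>x. f (x, snd z)) (fst z) = fst (grad f z)"
    by (intro grad_eqI) (simp add: gderiv_def inner_prod_def)
  have "((\<lambda>y. f (fst z, y)) has_derivative (\<lambda>h. (0, h) \<bullet> grad f z)) (at (snd z))"
    by (rule has_derivative_compose[of "\<lambda>y. (fst z, y)", OF _ f])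
      (auto intro!: derivative_eq_intros)
  then have 2: "grad (\<lambda>y. f (fst z, y)) (snd z) = snd (grad f z)"
    by (intro grad_eqI) (simp add: gderiv_def inner_prod_def)
  show ?thesis
    by (simp add: saddle_op_def flip_snd_def 1 2)
qed

locale smooth_saddle =
  fixes f :: "'a::euclidean_space \<times> 'b::euclidean_space \<Rightarrow> real" and lam L1 \<mu> :: real
  assumes lam: "lam > 0" and L1: "L1 > 0" and mu: "\<mu> > 0"
    and f_diff: "\<And>z. f differentiable (at z)"
    and f_Lip: "\<And>z1 z2. B_dual_norm lam (grad f z1 - grad f z2) \<le> L1 * B_norm lam (z1 - z2)"
begin

text \<open>The \<Phi> of the overview. Taken as the mean of the oracle, it makes the batches
  unbiased by definition; its expression through \<open>saddle_op f\<close> is the separate fact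
  \<open>mean_oracle_eq\<close>.\<close>

definition mean_oracle :: "'a \<times> 'b \<Rightarrow> 'a \<times> 'b" where
  "mean_oracle z = (\<integral>u. zo_oracle lam \<mu> f z u \<partial>gaussian lam)"

lemma prob_space_gaussian_lam: "prob_space (gaussian lam :: ('a \<times> 'b) measure)"
  using lam by (rule prob_space_gaussian)

text \<open>Each of the two weighted norms contributes a factor \<open>sqrt lam\<close>.\<close>

lemma grad_Lipschitz: "norm (grad f a - grad f b) \<le> lam * L1 * norm (a - b)"
proof -
  have "norm (grad f a - grad f b) \<le> sqrt lam * (L1 * (sqrt lam * norm (a - b)))"
    using f_Lip[of a b] lam by (simp add: B_norm_eq B_dual_norm_eq field_simps)
  also have "\<dots> = lam * L1 * norm (a - b)"
    using lam by (simp add: power2_eq_square)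
  finally show ?thesis .
qed

lemma saddle_Lipschitz: "norm (saddle_op f a - saddle_op f b) \<le> lam * L1 * norm (a - b)"
  using grad_Lipschitz[of a b] by (simp add: saddle_op_eq_grad f_diff flip: flip_snd_diff)

lemma f_continuous: "continuous_on UNIV f"
  using f_diff by (simp add: continuous_at_imp_continuous_on differentiable_imp_continuous_within)

lemma f_measurable [measurable]: "f \<in> borel_measurable borel"
  using f_continuous by (rule borel_measurable_continuous_onI)

lemma saddle_continuous: "continuous_on UNIV (saddle_op f)"
  using lam L1 by (intro lipschitz_on_continuous_on[where L = "lam * L1"] lipschitz_onI)
    (simp_all add: dist_norm saddle_Lipschitz)

lemma saddle_measurable [measurable]: "saddle_op f \<in> borel_measurable borel"
  using saddle_continuous by (rule borel_measurable_continuous_onI)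

lemma grad_measurable [measurable]: "grad f \<in> borel_measurable borel"
  using lam L1 by (intro borel_measurable_continuous_onI lipschitz_on_continuous_on[where L = "lam * L1"]
    lipschitz_onI) (simp_all add: dist_norm grad_Lipschitz)

lemma grad_growth:
  "norm (grad f (z + \<mu> *\<^sub>R u)) \<le> (norm (grad f z) + lam * L1 * \<mu>) * (1 + norm u)"
proof -
  have "norm (grad f (z + \<mu> *\<^sub>R u)) \<le> norm (grad f z) + lam * L1 * \<mu> * norm u"
    using grad_Lipschitz[of "z + \<mu> *\<^sub>R u" z] norm_triangle_sub[of "grad f (z + \<mu> *\<^sub>R u)" "grad f z"] mu
    by simp
  also have "\<dots> \<le> (norm (grad f z) + lam * L1 * \<mu>) * (1 + norm u)"
    using lam L1 mu by (simp add: algebra_simps add_increasing)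
  finally show ?thesis .
qed

text \<open>Mean value inequality on the segment from z to z + \<mu> u: the derivative in the
  segment parameter brings \<mu> and one factor \<open>norm u\<close>, the linear growth of the
  gradient brings the second.\<close>

lemma difference_quotient_growth:
  "\<bar>(f (z + \<mu> *\<^sub>R u) - f z) / \<mu>\<bar> \<le> (norm (grad f z) + lam * L1 * \<mu>) * (1 + norm u)\<^sup>2"
proof -
  define C where "C = norm (grad f z) + lam * L1 * \<mu>"
  have C: "C \<ge> 0"
    using lam L1 mu by (simp add: C_def)
  have der: "((\<lambda>s. f (z + \<mu> *\<^sub>R (s *\<^sub>R u))) has_derivative
      (\<lambda>h. (h * \<mu>) * (u \<bullet> grad f (z + \<mu> *\<^sub>R (s *\<^sub>R u))))) (at s within {0..1})" for s :: real
  proof -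
    have "((\<lambda>s. f (z + \<mu> *\<^sub>R (s *\<^sub>R u))) has_derivative
      (\<lambda>h. (\<mu> *\<^sub>R (h *\<^sub>R u)) \<bullet> grad f (z + \<mu> *\<^sub>R (s *\<^sub>R u)))) (at s within {0..1})"
      by (rule has_derivative_compose[of "\<lambda>s. z + \<mu> *\<^sub>R (s *\<^sub>R u)",
            OF _ GDERIV_grad[OF f_diff, unfolded gderiv_def]])
        (auto intro!: derivative_eq_intros)
    then show ?thesis
      by (simp add: mult_ac)
  qed
  have "\<bar>f (z + \<mu> *\<^sub>R (1 *\<^sub>R u)) - f (z + \<mu> *\<^sub>R ((0::real) *\<^sub>R u))\<bar> \<le> \<mu> * (norm u * (C * (1 + norm u))) * norm (1 - 0 :: real)"
    unfolding real_norm_def[symmetric]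
  proof (rule differentiable_bound[OF _ der])
    fix s :: real assume s: "s \<in> {0..1}"
    have "\<bar>u \<bullet> grad f (z + \<mu> *\<^sub>R (s *\<^sub>R u))\<bar> \<le> norm u * norm (grad f (z + \<mu> *\<^sub>R (s *\<^sub>R u)))"
      by (rule Cauchy_Schwarz_ineq2)
    also have "\<dots> \<le> norm u * (C * (1 + norm (s *\<^sub>R u)))"
      using grad_growth[of z "s *\<^sub>R u"] by (intro mult_left_mono) (auto simp: C_def)
    also have "\<dots> \<le> norm u * (C * (1 + norm u))"
      using C s by (intro mult_left_mono add_left_mono) (auto simp: mult_left_le_one_le)
    finally have *: "\<bar>u \<bullet> grad f (z + \<mu> *\<^sub>R (s *\<^sub>R u))\<bar> \<le> norm u * (C * (1 + norm u))" .
    show "onorm (\<lambda>h. (h * \<mu>) * (u \<bullet> grad f (z + \<mu> *\<^sub>R (s *\<^sub>R u)))) \<le> \<mu> * (norm u * (C * (1 + norm u)))"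
    proof (rule onorm_le)
      fix h :: real
      have "norm ((h * \<mu>) * (u \<bullet> grad f (z + \<mu> *\<^sub>R (s *\<^sub>R u)))) = \<mu> * \<bar>h\<bar> * \<bar>u \<bullet> grad f (z + \<mu> *\<^sub>R (s *\<^sub>R u))\<bar>"
        using mu by (simp add: abs_mult)
      also have "\<dots> \<le> \<mu> * \<bar>h\<bar> * (norm u * (C * (1 + norm u)))"
        using mu * by (intro mult_left_mono) auto
      finally show "norm ((h * \<mu>) * (u \<bullet> grad f (z + \<mu> *\<^sub>R (s *\<^sub>R u)))) \<le> \<mu> * (norm u * (C * (1 + norm u))) * norm h"
        by (simp add: mult_ac)
    qed
  qed auto
  then have "\<bar>(f (z + \<mu> *\<^sub>R u) - f z) / \<mu>\<bar> \<le> norm u * (C * (1 + norm u))"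
    using mu by (simp add: field_simps)
  also have "\<dots> \<le> (1 + norm u) * (C * (1 + norm u))"
    using C by (intro mult_right_mono) auto
  finally show ?thesis
    by (simp add: C_def power2_eq_square mult_ac)
qed

lemma zo_oracle_eq_flip:
  "zo_oracle lam \<mu> f z u = flip_snd (lam *\<^sub>R (((f (z + \<mu> *\<^sub>R u) - f z) / \<mu>) *\<^sub>R u))"
  by (simp add: zo_oracle_def flip_snd_def mult_ac)

lemma difference_quotient_scaleR_growth:
  "norm (((f (z + \<mu> *\<^sub>R u) - f z) / \<mu>) *\<^sub>R u)
    \<le> (norm (grad f z) + lam * L1 * \<mu>) * (1 + norm u) ^ 3"
proof -
  have "norm (((f (z + \<mu> *\<^sub>R u) - f z) / \<mu>) *\<^sub>R u) = \<bar>(f (z + \<mu> *\<^sub>R u) - f z) / \<mu>\<bar> * norm u"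
    by (rule norm_scaleR)
  also have "\<dots> \<le> ((norm (grad f z) + lam * L1 * \<mu>) * (1 + norm u)\<^sup>2) * (1 + norm u)"
    using lam L1 mu by (intro mult_mono difference_quotient_growth) simp_all
  also have "\<dots> = (norm (grad f z) + lam * L1 * \<mu>) * (1 + norm u) ^ 3"
    by (simp only: power2_eq_square power3_eq_cube mult_ac)
  finally show ?thesis .
qed

lemma zo_oracle_growth:
  "norm (zo_oracle lam \<mu> f z u) \<le> lam * (norm (grad f z) + lam * L1 * \<mu>) * (1 + norm u) ^ 3"
  using mult_left_mono[OF difference_quotient_scaleR_growth[of z u], of lam] lam
  by (simp add: zo_oracle_eq_flip abs_mult mult.assoc)

lemma zo_oracle_measurable [measurable]: "zo_oracle lam \<mu> f z \<in> borel_measurable borel"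
  unfolding zo_oracle_eq_flip by measurable

lemma integrable_zo_oracle_norm_sq:
  "integrable (gaussian lam) (\<lambda>u. (norm (zo_oracle lam \<mu> f z u))\<^sup>2)"
proof (rule integrable_gaussian_poly_growth[OF lam, where k = 6])
  fix u :: "'a \<times> 'b"
  show "norm ((norm (zo_oracle lam \<mu> f z u))\<^sup>2)
      \<le> (lam * (norm (grad f z) + lam * L1 * \<mu>))\<^sup>2 * (1 + norm u) ^ 6"
    using power_mono[OF zo_oracle_growth[of z u] norm_ge_zero, of 2]
    by (simp add: power_mult_distrib flip: power_mult)
qed measurable

lemma integrable_saddle_shift_norm_sq:
  "integrable (gaussian lam) (\<lambda>u. (norm (saddle_op f (z + \<mu> *\<^sub>R u)))\<^sup>2)"
proof (rule integrable_gaussian_poly_growth[OF lam, where k = 2])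
  show "norm ((norm (saddle_op f (z + \<mu> *\<^sub>R u)))\<^sup>2)
      \<le> (norm (grad f z) + lam * L1 * \<mu>)\<^sup>2 * (1 + norm u)\<^sup>2" for u
    using power_mono[OF grad_growth[of z u] norm_ge_zero, of 2]
    by (simp add: saddle_op_eq_grad f_diff power_mult_distrib)
qed measurable

lemma integrable_saddle_shift: "integrable (gaussian lam) (\<lambda>u. saddle_op f (z + \<mu> *\<^sub>R u))"
  using prob_space.integrable_of_norm_sq[OF prob_space_gaussian_lam _ integrable_saddle_shift_norm_sq]
  by simp

text \<open>Integration by parts for the difference quotient as a function of \<open>u\<close>: its
  gradient is \<open>grad f (z + \<mu> *\<^sub>R u)\<close>, since the inner derivative \<mu>
  cancels the denominator. The bounded linear \<open>flip_snd\<close> then passes through the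
  integral.\<close>

lemma mean_oracle_eq: "mean_oracle z = (\<integral>u. saddle_op f (z + \<mu> *\<^sub>R u) \<partial>gaussian lam)"
proof -
  let ?\<phi> = "\<lambda>u. (f (z + \<mu> *\<^sub>R u) - f z) / \<mu>" and ?C = "norm (grad f z) + lam * L1 * \<mu>"
  \<comment> \<open>The gradient grows linearly; the exponent is raised to 2 because integration by
    parts takes one common bound for the function and its gradient.\<close>
  have growth: "norm (grad f (z + \<mu> *\<^sub>R u)) \<le> ?C * (1 + norm u)\<^sup>2" for u
  proof -
    have "?C * (1 + norm u) \<le> ?C * (1 + norm u)\<^sup>2"
      using lam L1 mu power_increasing[of 1 2 "1 + norm u"] by (intro mult_left_mono) auto
    then show ?thesis
      using grad_growth order_trans by blast
  qed
  have "GDERIV ?\<phi> u :> grad f (z + \<mu> *\<^sub>R u)" for u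
  proof -
    have "((\<lambda>u. f (z + \<mu> *\<^sub>R u)) has_derivative (\<lambda>h. (\<mu> *\<^sub>R h) \<bullet> grad f (z + \<mu> *\<^sub>R u))) (at u)"
      by (rule has_derivative_compose[of "\<lambda>u. z + \<mu> *\<^sub>R u",
            OF _ GDERIV_grad[OF f_diff, unfolded gderiv_def]])
        (auto intro!: derivative_eq_intros)
    then have "(?\<phi> has_derivative (\<lambda>h. ((\<mu> *\<^sub>R h) \<bullet> grad f (z + \<mu> *\<^sub>R u) - 0) / \<mu>)) (at u)"
      by (intro bounded_linear.has_derivative[OF bounded_linear_divide]
          has_derivative_diff has_derivative_const)
    then show ?thesis
      using mu by (simp add: gderiv_def)
  qed
  then have parts: "lam *\<^sub>R (\<integral>u. ?\<phi> u *\<^sub>R u \<partial>gaussian lam) = (\<integral>u. grad f (z + \<mu> *\<^sub>R u) \<partial>gaussian lam)"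
    by (rule gaussian_integration_by_parts[OF lam _ _ difference_quotient_growth growth]) simp
  have int: "integrable (gaussian lam) (\<lambda>u. grad f (z + \<mu> *\<^sub>R u))"
    by (rule integrable_gaussian_poly_growth[OF lam _ growth]) simp
  have "integrable (gaussian lam) (\<lambda>u. ?\<phi> u *\<^sub>R u)"
  proof (rule integrable_gaussian_poly_growth[OF lam, where C = ?C and k = 3])
    show "norm (?\<phi> u *\<^sub>R u) \<le> ?C * (1 + norm u) ^ 3" for u
      by (rule difference_quotient_scaleR_growth)
  qed measurable
  then have "integrable (gaussian lam) (\<lambda>u. lam *\<^sub>R (?\<phi> u *\<^sub>R u))"
    by (rule integrable_scaleR_right)
  from integral_bounded_linear[OF bounded_linear_flip_snd this]
  have "mean_oracle z = flip_snd (\<integral>u. grad f (z + \<mu> *\<^sub>R u) \<partial>gaussian lam)"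
    unfolding mean_oracle_def zo_oracle_eq_flip integral_scaleR_right parts .
  also have "\<dots> = (\<integral>u. saddle_op f (z + \<mu> *\<^sub>R u) \<partial>gaussian lam)"
    by (simp add: saddle_op_eq_grad f_diff integral_bounded_linear[OF bounded_linear_flip_snd int])
  finally show ?thesis .
qed

lemma mean_oracle_Lipschitz: "norm (mean_oracle a - mean_oracle b) \<le> lam * L1 * norm (a - b)"
proof -
  interpret prob_space "gaussian lam :: ('a \<times> 'b) measure"
    by (rule prob_space_gaussian_lam)
  have "norm (mean_oracle a - mean_oracle b) =
      norm (expectation (\<lambda>u. saddle_op f (a + \<mu> *\<^sub>R u) - saddle_op f (b + \<mu> *\<^sub>R u)))"
    by (simp add: mean_oracle_eq integrable_saddle_shift)
  also have "\<dots> \<le> expectation (\<lambda>u. norm (saddle_op f (a + \<mu> *\<^sub>R u) - saddle_op f (b + \<mu> *\<^sub>R u)))"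
    by (rule integral_norm_bound)
  also have "\<dots> \<le> expectation (\<lambda>u. lam * L1 * norm (a - b))"
  proof (rule integral_mono)
    show "norm (saddle_op f (a + \<mu> *\<^sub>R u) - saddle_op f (b + \<mu> *\<^sub>R u)) \<le> lam * L1 * norm (a - b)" for u
      using saddle_Lipschitz[of "a + \<mu> *\<^sub>R u" "b + \<mu> *\<^sub>R u"] by simp
  qed (auto intro!: integrable_norm Bochner_Integration.integrable_diff integrable_saddle_shift)
  finally show ?thesis
    using prob_space by simp
qed

lemma mean_oracle_continuous: "continuous_on UNIV mean_oracle"
  using lam L1 by (intro lipschitz_on_continuous_on[where L = "lam * L1"] lipschitz_onI)
    (simp_all add: dist_norm mean_oracle_Lipschitz)

lemma mean_oracle_measurable [measurable]: "mean_oracle \<in> borel_measurable borel"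
  using mean_oracle_continuous by (rule borel_measurable_continuous_onI)

text \<open>The squared Lipschitz bound is (lam L1 \<mu>)^2 |u|^2, and E |u|^2 = d / lam removes one
  factor \<open>lam\<close>.\<close>

lemma saddle_shift_second_moment:
  "(\<integral>u. (norm (saddle_op f (z + \<mu> *\<^sub>R u) - saddle_op f z))\<^sup>2 \<partial>gaussian lam)
    \<le> lam * L1\<^sup>2 * \<mu>\<^sup>2 * DIM('a \<times> 'b)"
proof -
  interpret prob_space "gaussian lam :: ('a \<times> 'b) measure"
    by (rule prob_space_gaussian_lam)
  have "expectation (\<lambda>u. (norm (saddle_op f (z + \<mu> *\<^sub>R u) - saddle_op f z))\<^sup>2)
      \<le> expectation (\<lambda>u. (lam * L1 * \<mu>)\<^sup>2 * (norm u)\<^sup>2)"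
  proof (rule integral_mono)
    show "(norm (saddle_op f (z + \<mu> *\<^sub>R u) - saddle_op f z))\<^sup>2 \<le> (lam * L1 * \<mu>)\<^sup>2 * (norm u)\<^sup>2" for u
      using power_mono[OF saddle_Lipschitz[of "z + \<mu> *\<^sub>R u" z] norm_ge_zero, of 2] mu
      by (simp add: power_mult_distrib mult_ac)
  qed (auto intro!: integrable_norm_sq_diff integrable_saddle_shift_norm_sq
      integrable_gaussian_norm_sq lam)
  also have "\<dots> = (lam * L1 * \<mu>)\<^sup>2 * (DIM('a \<times> 'b) / lam)"
    by (simp only: integral_mult_right_zero gaussian_second_moment[OF lam])
  also have "\<dots> = lam * L1\<^sup>2 * \<mu>\<^sup>2 * DIM('a \<times> 'b)"
    using lam by (simp add: power2_eq_square)
  finally show ?thesis .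
qed

text \<open>The squared bias falls short of the second moment about \<open>saddle_op f z\<close> by
  a variance.\<close>

lemma mean_oracle_bias: "(norm (mean_oracle z - saddle_op f z))\<^sup>2 \<le> lam * L1\<^sup>2 * \<mu>\<^sup>2 * DIM('a \<times> 'b)"
proof -
  interpret prob_space "gaussian lam :: ('a \<times> 'b) measure"
    by (rule prob_space_gaussian_lam)
  show ?thesis
    using saddle_shift_second_moment[of z]
      expectation_norm_sq_diff[of "\<lambda>u. saddle_op f (z + \<mu> *\<^sub>R u)" "saddle_op f z"]
    by (simp add: integrable_saddle_shift_norm_sq flip: mean_oracle_eq)
      (smt (verit) Bochner_Integration.integral_nonneg zero_le_power2)
qed

text \<open>The weak Minty inequality at the random point \<open>z + \<mu> u\<close> is averaged over \<open>u\<close>; this avoids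
  estimating \<open>\<langle>F z - F\<^sub>\<mu> z, z - z\<^sup>*\<rangle>\<close>, which is not bounded in \<open>z\<close>.\<close>

lemma mean_oracle_weak_Minty:
  assumes \<rho>: "\<rho> \<ge> 0"
    and Minty: "\<And>z. saddle_op f z \<bullet> (z - zs) + \<rho> / 2 * (B_dual_norm lam (saddle_op f z))\<^sup>2 \<ge> 0"
  shows "mean_oracle z \<bullet> (z - zs) + \<rho> / (2 * lam) * (norm (mean_oracle z))\<^sup>2
    + \<mu>\<^sup>2 * L1 * DIM('a \<times> 'b) * (1 + \<rho> * L1 / 2) \<ge> 0"
proof -
  interpret prob_space "gaussian lam :: ('a \<times> 'b) measure"
    by (rule prob_space_gaussian_lam)
  define X where "X u = saddle_op f (z + \<mu> *\<^sub>R u)" for u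
  have X [measurable]: "X \<in> borel_measurable borel"
    unfolding X_def by measurable
  have int: "integrable (gaussian lam) X" "integrable (gaussian lam) (\<lambda>u. (norm (X u))\<^sup>2)"
    unfolding X_def by (rule integrable_saddle_shift integrable_saddle_shift_norm_sq)+
  have mean: "expectation X = mean_oracle z"
    by (simp add: mean_oracle_eq X_def[abs_def])
  have u: "integrable (gaussian lam) (\<lambda>u::'a \<times> 'b. u)"
    by (rule integrable_of_norm_sq) (simp_all add: integrable_gaussian_norm_sq lam)
  define d where "d = real DIM('a \<times> 'b)"
  \<comment> \<open>To express the \<rho> term through \<Phi>(z), the second moment of
    \<open>X\<close> is split into |\<Phi>(z)|^2 and a variance; the latter is at most the second
    moment about F(z), of order \<mu>^2.\<close>
  have "expectation (\<lambda>u. (norm (X u))\<^sup>2) = (norm (mean_oracle z))\<^sup>2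
      + expectation (\<lambda>u. (norm (X u - mean_oracle z))\<^sup>2)"
    using expectation_norm_sq_diff[of X 0] int mean by simp
  moreover have "expectation (\<lambda>u. (norm (X u - mean_oracle z))\<^sup>2)
      \<le> expectation (\<lambda>u. (norm (X u - saddle_op f z))\<^sup>2)"
    using expectation_norm_sq_diff[of X "saddle_op f z"] int mean by simp
  moreover have "expectation (\<lambda>u. (norm (X u - saddle_op f z))\<^sup>2) \<le> lam * L1\<^sup>2 * \<mu>\<^sup>2 * d"
    using saddle_shift_second_moment[of z] by (simp add: X_def d_def)
  ultimately have second: "expectation (\<lambda>u. (norm (X u))\<^sup>2)
      \<le> (norm (mean_oracle z))\<^sup>2 + lam * L1\<^sup>2 * \<mu>\<^sup>2 * d"
    by simp
  \<comment> \<open>Subtracting \<mu> <F(z), u>, whose mean is zero, leaves \<mu> <X u - F(z), u>,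
    which the Lipschitz bound makes quadratic in \<mu>.\<close>
  have pointwise: "- (X u \<bullet> (z - zs)) - \<rho> / (2 * lam) * (norm (X u))\<^sup>2 - \<mu> * (saddle_op f z \<bullet> u)
      \<le> lam * L1 * \<mu>\<^sup>2 * (norm u)\<^sup>2" for u
  proof -
    have "(X u - saddle_op f z) \<bullet> u \<le> norm (X u - saddle_op f z) * norm u"
      by (rule norm_cauchy_schwarz)
    also have "\<dots> \<le> (lam * L1 * (\<mu> * norm u)) * norm u"
      using saddle_Lipschitz[of "z + \<mu> *\<^sub>R u" z] mu by (intro mult_right_mono) (auto simp: X_def)
    finally have "\<mu> * ((X u - saddle_op f z) \<bullet> u) \<le> \<mu> * ((lam * L1 * (\<mu> * norm u)) * norm u)"
      using mu by (intro mult_left_mono) auto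
    then have 1: "\<mu> * (X u \<bullet> u) - \<mu> * (saddle_op f z \<bullet> u) \<le> lam * L1 * \<mu>\<^sup>2 * (norm u)\<^sup>2"
      by (simp add: inner_diff_left power2_eq_square algebra_simps)
    have "(B_dual_norm lam (X u))\<^sup>2 = (norm (X u))\<^sup>2 / lam"
      using lam by (simp add: B_dual_norm_eq power_divide)
    then have "0 \<le> X u \<bullet> (z + \<mu> *\<^sub>R u - zs) + \<rho> / (2 * lam) * (norm (X u))\<^sup>2"
      using Minty[of "z + \<mu> *\<^sub>R u"] by (simp add: X_def)
    moreover have "X u \<bullet> (z + \<mu> *\<^sub>R u - zs) = X u \<bullet> (z - zs) + \<mu> * (X u \<bullet> u)"
      by (simp add: inner_diff_right inner_add_right)
    ultimately show ?thesis
      using 1 by linarith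
  qed
  have "- (mean_oracle z \<bullet> (z - zs)) - \<rho> / (2 * lam) * expectation (\<lambda>u. (norm (X u))\<^sup>2)
    = expectation (\<lambda>u. - (X u \<bullet> (z - zs)) - \<rho> / (2 * lam) * (norm (X u))\<^sup>2 - \<mu> * (saddle_op f z \<bullet> u))"
    using int u lam gaussian_mean[OF lam, where 'a = "'a \<times> 'b"] by (simp add: mean)
  also have "\<dots> \<le> expectation (\<lambda>u::'a \<times> 'b. lam * L1 * \<mu>\<^sup>2 * (norm u)\<^sup>2)"
    using int u lam pointwise integrable_gaussian_norm_sq[OF lam, where 'a = "'a \<times> 'b"]
    by (intro integral_mono) auto
  also have "\<dots> = L1 * \<mu>\<^sup>2 * d"
    using lam by (simp add: gaussian_second_moment d_def)
  finally have "- (mean_oracle z \<bullet> (z - zs)) \<le> L1 * \<mu>\<^sup>2 * d + \<rho> / (2 * lam) * expectation (\<lambda>u. (norm (X u))\<^sup>2)"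
    by simp
  also have "\<dots> \<le> L1 * \<mu>\<^sup>2 * d + \<rho> / (2 * lam) * ((norm (mean_oracle z))\<^sup>2 + lam * L1\<^sup>2 * \<mu>\<^sup>2 * d)"
    using \<rho> lam second by (intro add_left_mono mult_left_mono) auto
  also have "\<dots> = \<rho> / (2 * lam) * (norm (mean_oracle z))\<^sup>2 + \<mu>\<^sup>2 * L1 * d * (1 + \<rho> * L1 / 2)"
    using lam by (simp add: field_simps power2_eq_square)
  finally show ?thesis
    by (simp add: d_def)
qed

text \<open>The centre \<open>c\<close> is arbitrary, so F_\<mu>(z) can be inserted without
  identifying it with \<Phi>(z). The factor \<open>lam\<close> undoes the dual norm.\<close>

lemma zo_oracle_variance:
  assumes "(\<integral>v. (B_dual_norm lam (zo_oracle lam \<mu> f z v - c))\<^sup>2 \<partial>gaussian lam) \<le> \<sigma>\<^sup>2"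
  shows "(\<integral>v. (norm (zo_oracle lam \<mu> f z v - mean_oracle z))\<^sup>2 \<partial>gaussian lam) \<le> lam * \<sigma>\<^sup>2"
proof -
  interpret prob_space "gaussian lam :: ('a \<times> 'b) measure"
    by (rule prob_space_gaussian_lam)
  have "(\<lambda>v. (B_dual_norm lam (zo_oracle lam \<mu> f z v - c))\<^sup>2) = (\<lambda>v. (norm (zo_oracle lam \<mu> f z v - c))\<^sup>2 / lam)"
    using lam by (simp add: B_dual_norm_eq power_divide)
  then have "expectation (\<lambda>v. (norm (zo_oracle lam \<mu> f z v - c))\<^sup>2) \<le> lam * \<sigma>\<^sup>2"
    using assms lam by (simp add: field_simps)
  then show ?thesis
    using expectation_norm_sq_diff[of "zo_oracle lam \<mu> f z" c] integrable_zo_oracle_norm_sq[of z]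
    by (simp flip: mean_oracle_def) (smt (verit) zero_le_power2)
qed

end

section \<open>Independent random vectors\<close>

text \<open>Stands in for conditioning on \<open>X\<close>: the joint law is a product, so
  \<open>X\<close> can be frozen while \<open>Y\<close> is averaged. For nonnegative
  \<open>g\<close> this asks for no integrability.\<close>

lemma (in prob_space) nn_integral_indep_var:
  assumes indep: "indep_var S X T Y" and g [measurable]: "g \<in> borel_measurable (S \<Otimes>\<^sub>M T)"
  shows "(\<integral>\<^sup>+\<omega>. g (X \<omega>, Y \<omega>) \<partial>M) = (\<integral>\<^sup>+\<omega>. (\<integral>\<^sup>+\<omega>'. g (X \<omega>, Y \<omega>') \<partial>M) \<partial>M)"
proof -
  have X [measurable]: "random_variable S X" and Y [measurable]: "random_variable T Y"
    and eq: "distr M S X \<Otimes>\<^sub>M distr M T Y = distr M (S \<Otimes>\<^sub>M T) (\<lambda>\<omega>. (X \<omega>, Y \<omega>))"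
    using indep by (auto simp: indep_var_distribution_eq)
  interpret Y: prob_space "distr M T Y"
    by (rule prob_space_distr) measurable
  have "(\<integral>\<^sup>+\<omega>. g (X \<omega>, Y \<omega>) \<partial>M) = integral\<^sup>N (distr M S X \<Otimes>\<^sub>M distr M T Y) g"
    unfolding eq by (subst nn_integral_distr) simp_all
  also have "\<dots> = (\<integral>\<^sup>+x. \<integral>\<^sup>+y. g (x, y) \<partial>distr M T Y \<partial>distr M S X)"
    by (rule Y.nn_integral_fst[symmetric]) measurable
  also have "\<dots> = (\<integral>\<^sup>+\<omega>. (\<integral>\<^sup>+y. g (X \<omega>, y) \<partial>distr M T Y) \<partial>M)"
    by (rule nn_integral_distr[OF X]) measurable
  also have "\<dots> = (\<integral>\<^sup>+\<omega>. (\<integral>\<^sup>+\<omega>'. g (X \<omega>, Y \<omega>') \<partial>M) \<partial>M)"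
  proof (rule nn_integral_cong)
    fix \<omega> assume "\<omega> \<in> space M"
    then have "X \<omega> \<in> space S"
      using X by (rule measurable_space[rotated])
    then show "(\<integral>\<^sup>+y. g (X \<omega>, y) \<partial>distr M T Y) = (\<integral>\<^sup>+\<omega>'. g (X \<omega>, Y \<omega>') \<partial>M)"
      by (intro nn_integral_distr) simp_all
  qed
  finally show ?thesis .
qed

lemma (in prob_space) indep_vars_imp_indep_var:
  assumes indep: "indep_vars (\<lambda>_. N) X I" and ij: "i \<in> I" "j \<in> I" "i \<noteq> j"
  shows "indep_var N (X i) N (X j)"
proof -
  have "indep_var N ((\<lambda>x. x i) \<circ> (\<lambda>\<omega>. restrict (\<lambda>k. X k \<omega>) {i}))
      N ((\<lambda>x. x j) \<circ> (\<lambda>\<omega>. restrict (\<lambda>k. X k \<omega>) {j}))"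
    using ij by (intro indep_var_compose[OF indep_var_restrict[OF indep]]) auto
  then show ?thesis
    by (simp add: comp_def)
qed

lemma (in prob_space) indep_var_inner_expectation:
  fixes X Y :: "'a \<Rightarrow> 'b::euclidean_space"
  assumes indep: "indep_var borel X borel Y" and int: "integrable M X" "integrable M Y"
  shows "integrable M (\<lambda>\<omega>. X \<omega> \<bullet> Y \<omega>)"
    and "expectation (\<lambda>\<omega>. X \<omega> \<bullet> Y \<omega>) = expectation X \<bullet> expectation Y"
proof -
  have coord: "indep_var borel (\<lambda>\<omega>. X \<omega> \<bullet> b) borel (\<lambda>\<omega>. Y \<omega> \<bullet> b)" for b
    using indep_var_compose[OF indep, of "\<lambda>x. x \<bullet> b" borel "\<lambda>x. x \<bullet> b" borel]
    by (simp add: comp_def)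
  have eq: "X \<omega> \<bullet> Y \<omega> = (\<Sum>b\<in>Basis. (X \<omega> \<bullet> b) * (Y \<omega> \<bullet> b))" for \<omega>
    by (rule euclidean_inner)
  have prod: "integrable M (\<lambda>\<omega>. (X \<omega> \<bullet> b) * (Y \<omega> \<bullet> b))"
    "expectation (\<lambda>\<omega>. (X \<omega> \<bullet> b) * (Y \<omega> \<bullet> b)) = (expectation X \<bullet> b) * (expectation Y \<bullet> b)" for b
    using indep_var_integrable[OF coord, of b] indep_var_lebesgue_integral[OF coord, of b] int
    by simp_all
  show "integrable M (\<lambda>\<omega>. X \<omega> \<bullet> Y \<omega>)"
    unfolding eq using prod by simp
  show "expectation (\<lambda>\<omega>. X \<omega> \<bullet> Y \<omega>) = expectation X \<bullet> expectation Y"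
    unfolding eq by (subst euclidean_inner)
      (simp only: Bochner_Integration.integral_sum prod)
qed

text \<open>The off-diagonal inner products of independent centred vectors have expectation zero.
  This is the source of the factor 1 / t for batches.\<close>

lemma (in prob_space) expectation_norm_sq_sum_indep:
  fixes Y :: "'i \<Rightarrow> 'a \<Rightarrow> 'b::euclidean_space"
  assumes fin: "finite I" and indep: "indep_vars (\<lambda>_. borel) Y I"
    and sq: "\<And>i. i \<in> I \<Longrightarrow> integrable M (\<lambda>\<omega>. (norm (Y i \<omega>))\<^sup>2)"
    and mean: "\<And>i. i \<in> I \<Longrightarrow> expectation (Y i) = 0"
  shows "integrable M (\<lambda>\<omega>. (norm (\<Sum>i\<in>I. Y i \<omega>))\<^sup>2)"
    and "expectation (\<lambda>\<omega>. (norm (\<Sum>i\<in>I. Y i \<omega>))\<^sup>2) = (\<Sum>i\<in>I. expectation (\<lambda>\<omega>. (norm (Y i \<omega>))\<^sup>2))"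
proof -
  have meas: "Y i \<in> borel_measurable M" if "i \<in> I" for i
    using indep that by (auto simp: indep_vars_def)
  have int: "integrable M (Y i)" if "i \<in> I" for i
    using integrable_of_norm_sq meas sq that by blast
  have eq: "(norm (\<Sum>i\<in>I. Y i \<omega>))\<^sup>2 = (\<Sum>i\<in>I. \<Sum>j\<in>I. Y i \<omega> \<bullet> Y j \<omega>)" for \<omega>
    by (simp only: power2_norm_eq_inner inner_sum_left inner_sum_right) (rule sum.swap)
  have cross: "integrable M (\<lambda>\<omega>. Y i \<omega> \<bullet> Y j \<omega>) \<and> expectation (\<lambda>\<omega>. Y i \<omega> \<bullet> Y j \<omega>) =
      (if i = j then expectation (\<lambda>\<omega>. (norm (Y i \<omega>))\<^sup>2) else 0)" if ij: "i \<in> I" "j \<in> I" for i j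
  proof (cases "i = j")
    case True
    then show ?thesis
      using sq ij by (simp add: power2_norm_eq_inner)
  next
    case False
    note indep_var_inner_expectation[OF indep_vars_imp_indep_var[OF indep ij False] int int]
    then show ?thesis
      using ij mean False by simp
  qed
  show "integrable M (\<lambda>\<omega>. (norm (\<Sum>i\<in>I. Y i \<omega>))\<^sup>2)"
    unfolding eq using cross by (intro Bochner_Integration.integrable_sum) simp
  show "expectation (\<lambda>\<omega>. (norm (\<Sum>i\<in>I. Y i \<omega>))\<^sup>2) = (\<Sum>i\<in>I. expectation (\<lambda>\<omega>. (norm (Y i \<omega>))\<^sup>2))"
    unfolding eq using cross fin by (simp add: Bochner_Integration.integral_sum)
qed

subsection \<open>One extragradient step\<close>

text \<open>Deterministic core, with P = \<Phi>(y) evaluated exactly and \<open>A\<close> arbitrary.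
  Expanding |P - A|^2 once through \<Phi>(z) and once directly controls <P, A> and leaves -|P|^2,
  which becomes the decrease. The 3 before |e|^2 is 1 from the expansion plus 2 from passing to the
  noiseless point.\<close>

lemma extragradient_pointwise:
  fixes \<Phi> :: "'a::real_inner \<Rightarrow> 'a" and z zs A :: 'a
  assumes h: "h1 > 0" "h2 > 0" "h1 * K \<le> 1" and K: "K \<ge> 0"
    and Lip: "\<And>a b. norm (\<Phi> a - \<Phi> b) \<le> K * norm (a - b)"
    and Minty: "\<And>y. \<Phi> y \<bullet> (y - zs) + \<kappa> * (norm (\<Phi> y))\<^sup>2 + \<delta> \<ge> 0"
  defines "y \<equiv> z - h1 *\<^sub>R A" and "e \<equiv> A - \<Phi> z"
  shows "(norm (z - h2 *\<^sub>R \<Phi> y - zs))\<^sup>2 + (h1 * h2 - h2\<^sup>2 - 2 * h2 * \<kappa>) * (norm (\<Phi> y))\<^sup>2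
    \<le> (norm (z - zs))\<^sup>2 + 2 * h2 * \<delta>
      + h1 * h2 * (3 * (norm e)\<^sup>2 + 2 * ((\<Phi> z - \<Phi> (z - h1 *\<^sub>R \<Phi> z)) \<bullet> e))"
proof -
  define P where "P = \<Phi> y"
  \<comment> \<open>Extrapolation without noise: a function of \<open>z\<close> alone, at distance
    h1 |e| from \<open>y\<close>.\<close>
  define zb where "zb = z - h1 *\<^sub>R \<Phi> z"
  have contract: "K * norm (h1 *\<^sub>R v) \<le> norm v" for v :: 'a
    using mult_right_mono[OF h(3) norm_ge_zero[of v]] h by (simp add: mult_ac)
  have "norm (P - \<Phi> z) \<le> norm A"
    using Lip[of y z] contract[of A] by (simp add: P_def y_def)
  then have l1: "(norm (P - \<Phi> z))\<^sup>2 \<le> (norm A)\<^sup>2"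
    by (rule power_mono) simp
  have "y - zb = - (h1 *\<^sub>R e)"
    by (simp add: y_def zb_def e_def scaleR_diff_right)
  then have "norm (P - \<Phi> zb) \<le> norm e"
    using Lip[of y zb] contract[of e] by (simp add: P_def)
  then have "\<bar>(P - \<Phi> zb) \<bullet> e\<bar> \<le> norm e * norm e"
    using Cauchy_Schwarz_ineq2[of "P - \<Phi> zb" e] mult_right_mono[of _ _ "norm e"] norm_ge_zero
      order_trans by blast
  then have l2: "- ((P - \<Phi> zb) \<bullet> e) \<le> (norm e)\<^sup>2"
    by (simp add: power2_eq_square)
  have "(norm (P - A))\<^sup>2 = (norm (P - \<Phi> z))\<^sup>2 - 2 * ((P - \<Phi> zb) \<bullet> e) + 2 * ((\<Phi> z - \<Phi> zb) \<bullet> e) + (norm e)\<^sup>2"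
    by (simp add: e_def power2_norm_eq_inner inner_diff_left inner_diff_right inner_commute)
  moreover have "(norm (P - A))\<^sup>2 = (norm P)\<^sup>2 - 2 * (P \<bullet> A) + (norm A)\<^sup>2"
    by (simp add: power2_norm_eq_inner inner_diff_left inner_diff_right inner_commute)
  ultimately have "- 2 * (P \<bullet> A) \<le> 3 * (norm e)\<^sup>2 + 2 * ((\<Phi> z - \<Phi> zb) \<bullet> e) - (norm P)\<^sup>2"
    using l1 l2 by linarith
  then have 1: "h1 * h2 * (- 2 * (P \<bullet> A)) \<le> h1 * h2 * (3 * (norm e)\<^sup>2 + 2 * ((\<Phi> z - \<Phi> zb) \<bullet> e) - (norm P)\<^sup>2)"
    using h by (intro mult_left_mono) auto
  \<comment> \<open>Weak Minty is applied at \<open>y\<close>, where the operator of the update is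
    evaluated; the displacement h1 A from \<open>y\<close> to \<open>z\<close> is what produces <P,
    A>.\<close>
  have 2: "h2 * (- 2 * (P \<bullet> (y - zs))) \<le> h2 * (2 * \<kappa> * (norm P)\<^sup>2 + 2 * \<delta>)"
    using Minty[of y] h by (intro mult_left_mono) (auto simp: P_def)
  have "(norm (z - h2 *\<^sub>R P - zs))\<^sup>2 = (norm (z - zs))\<^sup>2 - 2 * h2 * (P \<bullet> (z - zs)) + h2\<^sup>2 * (norm P)\<^sup>2"
    unfolding power2_norm_eq_inner
    by (simp add: inner_diff_left inner_diff_right inner_commute)
      (simp add: power2_eq_square algebra_simps)
  moreover have "P \<bullet> (z - zs) = P \<bullet> (y - zs) + h1 * (P \<bullet> A)"
    by (simp add: y_def inner_diff_right)
  ultimately have "(norm (z - h2 *\<^sub>R P - zs))\<^sup>2 = (norm (z - zs))\<^sup>2 + h2 * (- 2 * (P \<bullet> (y - zs)))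
      + h1 * h2 * (- 2 * (P \<bullet> A)) + h2\<^sup>2 * (norm P)\<^sup>2"
    by (simp add: algebra_simps)
  with 1 2 show ?thesis
    unfolding P_def[symmetric] zb_def[symmetric] by (simp add: algebra_simps)
qed

text \<open>Average over the first batch with \<open>z\<close> frozen. It suffices that the upper
  bound \<open>R\<close> is integrable, and its inner-product term vanishes because \<open>A\<close>
  is unbiased. The constant \<open>c\<close> leaves room for the noise of the second batch.\<close>

lemma (in prob_space) extragradient_extrapolation:
  fixes \<Phi> :: "'b::euclidean_space \<Rightarrow> 'b"
  assumes h: "h1 > 0" "h2 > 0" "h1 * K \<le> 1" and K: "K \<ge> 0"
    and Lip: "\<And>a b. norm (\<Phi> a - \<Phi> b) \<le> K * norm (a - b)"
    and Minty: "\<And>y. \<Phi> y \<bullet> (y - zs) + \<kappa> * (norm (\<Phi> y))\<^sup>2 + \<delta> \<ge> 0"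
    and A [measurable]: "A \<in> borel_measurable M" and sq: "integrable M (\<lambda>\<omega>. (norm (A \<omega>))\<^sup>2)"
    and mean: "expectation A = \<Phi> z"
    and var: "expectation (\<lambda>\<omega>. (norm (A \<omega> - \<Phi> z))\<^sup>2) \<le> s2"
    and pos: "0 \<le> h1 * h2 - h2\<^sup>2 - 2 * h2 * \<kappa>" and c: "0 \<le> c"
  shows "(\<integral>\<^sup>+\<omega>. ennreal ((norm (z - h2 *\<^sub>R \<Phi> (z - h1 *\<^sub>R A \<omega>) - zs))\<^sup>2
      + (h1 * h2 - h2\<^sup>2 - 2 * h2 * \<kappa>) * (norm (\<Phi> (z - h1 *\<^sub>R A \<omega>)))\<^sup>2 + c) \<partial>M)
    \<le> ennreal ((norm (z - zs))\<^sup>2 + 2 * h2 * \<delta> + 3 * h1 * h2 * s2 + c)"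
proof -
  define R where "R \<omega> = (norm (z - zs))\<^sup>2 + 2 * h2 * \<delta> + c + (h1 * h2 * 3) * (norm (A \<omega> - \<Phi> z))\<^sup>2
      + (h1 * h2 * 2) * ((\<Phi> z - \<Phi> (z - h1 *\<^sub>R \<Phi> z)) \<bullet> (A \<omega> - \<Phi> z))" for \<omega>
  let ?Q = "\<lambda>\<omega>. (norm (z - h2 *\<^sub>R \<Phi> (z - h1 *\<^sub>R A \<omega>) - zs))\<^sup>2
      + (h1 * h2 - h2\<^sup>2 - 2 * h2 * \<kappa>) * (norm (\<Phi> (z - h1 *\<^sub>R A \<omega>)))\<^sup>2 + c"
  have Q_nonneg: "0 \<le> ?Q \<omega>" for \<omega>
    using pos c by (intro add_nonneg_nonneg mult_nonneg_nonneg zero_le_power2)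
  have Q_le: "?Q \<omega> \<le> R \<omega>" for \<omega>
    using extragradient_pointwise[OF h K Lip Minty, where z = z and A = "A \<omega>"]
    by (simp add: R_def distrib_left mult.assoc)
  have int: "integrable M A" "integrable M (\<lambda>\<omega>. (norm (A \<omega> - \<Phi> z))\<^sup>2)"
    using integrable_of_norm_sq[OF A sq] integrable_norm_sq_diff[OF A sq] by auto
  have R_int: "integrable M R"
    unfolding R_def using int by simp
  have "(\<integral>\<^sup>+\<omega>. ennreal (?Q \<omega>) \<partial>M) \<le> (\<integral>\<^sup>+\<omega>. ennreal (R \<omega>) \<partial>M)"
    using Q_le by (intro nn_integral_mono ennreal_leI)
  also have "\<dots> = ennreal (expectation R)"
    using order_trans[OF Q_nonneg Q_le] by (intro nn_integral_eq_integral[OF R_int] AE_I2)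
  also have "expectation R = (norm (z - zs))\<^sup>2 + 2 * h2 * \<delta> + c
      + (h1 * h2 * 3) * expectation (\<lambda>\<omega>. (norm (A \<omega> - \<Phi> z))\<^sup>2)"
    unfolding R_def using int mean by (simp add: prob_space)
  also have "\<dots> \<le> (norm (z - zs))\<^sup>2 + 2 * h2 * \<delta> + c + (h1 * h2 * 3) * s2"
    using h var by (intro add_left_mono mult_left_mono) auto
  finally show ?thesis
    by (simp add: mult_ac add_ac ennreal_leI)
qed

text \<open>Average over the second batch with its evaluation point frozen: putting the mean in
  place of \<open>B\<close> costs the variance of \<open>h *\<^sub>R B\<close>. The constant
  \<open>c\<close> will be the gain term, which this batch does not affect.\<close>

lemma (in prob_space) nn_integral_noisy_step:
  fixes B :: "'a \<Rightarrow> 'b::euclidean_space"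
  assumes B [measurable]: "B \<in> borel_measurable M" and sq: "integrable M (\<lambda>\<omega>. (norm (B \<omega>))\<^sup>2)"
    and mean: "expectation B = m"
    and var: "expectation (\<lambda>\<omega>. (norm (B \<omega> - m))\<^sup>2) \<le> s2" and c: "0 \<le> c"
  shows "(\<integral>\<^sup>+\<omega>. ennreal ((norm (z - h *\<^sub>R B \<omega> - zs))\<^sup>2 + c) \<partial>M)
    \<le> ennreal ((norm (z - h *\<^sub>R m - zs))\<^sup>2 + c + h\<^sup>2 * s2)"
proof -
  let ?X = "\<lambda>\<omega>. h *\<^sub>R B \<omega>"
  have sqX: "integrable M (\<lambda>\<omega>. (norm (?X \<omega>))\<^sup>2)"
    using sq by (simp add: power_mult_distrib)
  have B_int: "integrable M B"
    by (rule integrable_of_norm_sq[OF B sq])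
  have shift: "norm (z - v - zs) = norm (v - (z - zs))" for v
    by (simp add: norm_minus_commute algebra_simps)
  have "expectation (\<lambda>\<omega>. (norm (?X \<omega> - h *\<^sub>R m))\<^sup>2) \<le> h\<^sup>2 * s2"
    using var by (simp add: power_mult_distrib mult_left_mono flip: scaleR_diff_right)
  then have E: "expectation (\<lambda>\<omega>. (norm (z - ?X \<omega> - zs))\<^sup>2) \<le> (norm (z - h *\<^sub>R m - zs))\<^sup>2 + h\<^sup>2 * s2"
    using expectation_norm_sq_diff[of ?X "z - zs"] sqX B_int by (simp add: shift mean)
  have int: "integrable M (\<lambda>\<omega>. (norm (z - ?X \<omega> - zs))\<^sup>2)"
    unfolding shift using sqX by (intro integrable_norm_sq_diff) auto
  have "(\<integral>\<^sup>+\<omega>. ennreal ((norm (z - ?X \<omega> - zs))\<^sup>2 + c) \<partial>M)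
      = ennreal (expectation (\<lambda>\<omega>. (norm (z - ?X \<omega> - zs))\<^sup>2 + c))"
    using int c by (intro nn_integral_eq_integral) auto
  also have "expectation (\<lambda>\<omega>. (norm (z - ?X \<omega> - zs))\<^sup>2 + c) \<le> (norm (z - h *\<^sub>R m - zs))\<^sup>2 + c + h\<^sup>2 * s2"
    using int E by (simp add: prob_space)
  finally show ?thesis
    by (simp add: ennreal_leI)
qed

section \<open>Moments of a batch average\<close>

lemma integral_compose_law:
  fixes h :: "'b::topological_space \<Rightarrow> 'c::{banach, second_countable_topology}"
  assumes V: "V \<in> borel_measurable M" and law: "distr M borel V = D" and h: "integrable D h"
  shows "integrable M (\<lambda>\<omega>. h (V \<omega>))" "(\<integral>\<omega>. h (V \<omega>) \<partial>M) = (\<integral>x. h x \<partial>D)"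
proof -
  have "h \<in> borel_measurable borel"
    using h law by auto
  from integrable_distr_eq[OF V this] integral_distr[OF V this] h law
  show "integrable M (\<lambda>\<omega>. h (V \<omega>))" "(\<integral>\<omega>. h (V \<omega>) \<partial>M) = (\<integral>x. h x \<partial>D)"
    by simp_all
qed

text \<open>Here \<open>z\<close> is a fixed point, not a random iterate. The average is \<Phi>(z)
  plus 1 / t times a sum of t independent centred terms, so t variances are divided by t^2.\<close>

lemma (in smooth_saddle) batch_oracle_moments:
  fixes M :: "'w measure" and V :: "nat \<Rightarrow> 'w \<Rightarrow> 'a \<times> 'b"
  assumes prob: "prob_space M" and t: "t \<ge> 1"
    and indep: "prob_space.indep_vars M (\<lambda>_. borel) V {1..t}"
    and law: "\<And>i. i \<in> {1..t} \<Longrightarrow> distr M borel (V i) = gaussian lam"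
    and var: "(\<integral>v. (norm (zo_oracle lam \<mu> f z v - mean_oracle z))\<^sup>2 \<partial>gaussian lam) \<le> v"
  defines "A \<equiv> \<lambda>\<omega>. batch_oracle lam \<mu> f t (\<lambda>i. V i \<omega>) z"
  shows "A \<in> borel_measurable M" "integrable M (\<lambda>\<omega>. (norm (A \<omega>))\<^sup>2)"
    "(\<integral>\<omega>. A \<omega> \<partial>M) = mean_oracle z"
    "(\<integral>\<omega>. (norm (A \<omega> - mean_oracle z))\<^sup>2 \<partial>M) \<le> v / real t"
proof -
  interpret prob_space M by fact
  interpret G: prob_space "gaussian lam :: ('a \<times> 'b) measure"
    by (rule prob_space_gaussian_lam)
  define Y where "Y i \<omega> = zo_oracle lam \<mu> f z (V i \<omega>) - mean_oracle z" for i \<omega>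
  have V [measurable]: "V i \<in> borel_measurable M" if "i \<in> {1..t}" for i
    using indep that by (auto simp: indep_vars_def)
  have A_eq: "A \<omega> = mean_oracle z + (1 / real t) *\<^sub>R (\<Sum>i=1..t. Y i \<omega>)" for \<omega>
    using t by (simp add: A_def batch_oracle_def Y_def sum_subtractf scaleR_diff_right
        scaleR_conv_of_real[of "real t"] sum_constant_scaleR)
  have Y_indep: "indep_vars (\<lambda>_. borel) Y {1..t}"
    unfolding Y_def by (rule indep_vars_compose2[OF indep]) measurable
  have osq: "integrable (gaussian lam) (\<lambda>u. (norm (zo_oracle lam \<mu> f z u - mean_oracle z))\<^sup>2)"
    by (rule G.integrable_norm_sq_diff) (simp_all add: integrable_zo_oracle_norm_sq)
  have oint: "integrable (gaussian lam) (zo_oracle lam \<mu> f z)"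
    by (rule G.integrable_of_norm_sq) (simp_all add: integrable_zo_oracle_norm_sq)
  have Y_sq: "integrable M (\<lambda>\<omega>. (norm (Y i \<omega>))\<^sup>2)" "expectation (\<lambda>\<omega>. (norm (Y i \<omega>))\<^sup>2) \<le> v"
    if "i \<in> {1..t}" for i
    using integral_compose_law[OF V law osq] var that by (simp_all add: Y_def)
  have Y_mean: "expectation (Y i) = 0" if "i \<in> {1..t}" for i
    using integral_compose_law[OF V law oint] that by (simp add: Y_def[abs_def] mean_oracle_def prob_space)
  note sum = expectation_norm_sq_sum_indep[OF finite_atLeastAtMost Y_indep Y_sq(1) Y_mean]
  have Y_meas [measurable]: "Y i \<in> borel_measurable M" if "i \<in> {1..t}" for i
    using that unfolding Y_def by measurable
  have S_meas [measurable]: "(\<lambda>\<omega>. \<Sum>i=1..t. Y i \<omega>) \<in> borel_measurable M"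
    by (rule borel_measurable_sum) simp
  have diff: "A \<omega> - mean_oracle z = (1 / real t) *\<^sub>R (\<Sum>i=1..t. Y i \<omega>)" for \<omega>
    by (simp add: A_eq)
  show A_meas: "A \<in> borel_measurable M"
    unfolding A_eq[abs_def] by measurable
  have dsq: "integrable M (\<lambda>\<omega>. (norm (A \<omega> - mean_oracle z))\<^sup>2)"
    unfolding diff using sum(1) by (simp add: power_divide)
  \<comment> \<open>Known for the centred average; a shift by the constant -\<Phi>(z) transfers it
    to \<open>A\<close>.\<close>
  show "integrable M (\<lambda>\<omega>. (norm (A \<omega>))\<^sup>2)"
    using integrable_norm_sq_diff[of "\<lambda>\<omega>. A \<omega> - mean_oracle z" "- mean_oracle z"] dsq A_meas by simp
  have Y_int: "integrable M (Y i)" if "i \<in> {1..t}" for i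
    using integrable_of_norm_sq Y_meas Y_sq(1) that by blast
  then have "integrable M (\<lambda>\<omega>. \<Sum>i=1..t. Y i \<omega>)"
    by (rule Bochner_Integration.integrable_sum)
  moreover have "(\<integral>\<omega>. (\<Sum>i=1..t. Y i \<omega>) \<partial>M) = 0"
    using Y_int Y_mean by (subst Bochner_Integration.integral_sum) simp_all
  ultimately show "(\<integral>\<omega>. A \<omega> \<partial>M) = mean_oracle z"
    unfolding A_eq by (simp add: prob_space del: One_nat_def)
  have "(\<integral>\<omega>. (norm (A \<omega> - mean_oracle z))\<^sup>2 \<partial>M) = (1 / real t)\<^sup>2 * (\<Sum>i=1..t. expectation (\<lambda>\<omega>. (norm (Y i \<omega>))\<^sup>2))"
    unfolding diff using sum(2) by (simp add: power_divide del: One_nat_def)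
  also have "\<dots> \<le> (1 / real t)\<^sup>2 * (\<Sum>i=1..t. v)"
    using Y_sq(2) by (intro mult_left_mono sum_mono) auto
  also have "\<dots> = v / real t"
    using t by (simp add: power2_eq_square)
  finally show "(\<integral>\<omega>. (norm (A \<omega> - mean_oracle z))\<^sup>2 \<partial>M) \<le> v / real t" .
qed

subsection \<open>Independence of the iterates from fresh samples\<close>

text \<open>The step sizes enter as one step uses them: h1 \<Phi> is 1-Lipschitz, and the decrease
  has a nonnegative coefficient. The variance is already centred at \<Phi>.\<close>

locale zo_extragradient = smooth_saddle f lam L1 \<mu> + prob_space M
  for f :: "'a::euclidean_space \<times> 'b::euclidean_space \<Rightarrow> real" and lam L1 \<mu> :: real
    and M :: "'w measure" +
  fixes uhat u :: "nat \<Rightarrow> nat \<Rightarrow> 'w \<Rightarrow> 'a \<times> 'b" and z0 zs :: "'a \<times> 'b"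
    and h1 h2 \<sigma> \<rho> :: real and t N :: nat
  assumes variance: "\<And>z. (\<integral>v. (norm (zo_oracle lam \<mu> f z v - mean_oracle z))\<^sup>2 \<partial>gaussian lam)
      \<le> lam * \<sigma>\<^sup>2"
    and rho: "\<rho> \<ge> 0"
    and weak_Minty: "\<And>z. saddle_op f z \<bullet> (z - zs) + \<rho> / 2 * (B_dual_norm lam (saddle_op f z))\<^sup>2 \<ge> 0"
    and indep: "indep_vars (\<lambda>_. borel)
        (\<lambda>(first_batch, k, i). if first_batch then uhat k i else u k i)
        ((UNIV :: bool set) \<times> {0..N} \<times> {1..t})"
    and uhat_law: "\<And>k i. k \<in> {0..N} \<Longrightarrow> i \<in> {1..t} \<Longrightarrow> distr M borel (uhat k i) = gaussian lam"
    and u_law: "\<And>k i. k \<in> {0..N} \<Longrightarrow> i \<in> {1..t} \<Longrightarrow> distr M borel (u k i) = gaussian lam"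
    and t: "t \<ge> 1" and h: "h1 > 0" "h2 > 0" "h1 * (lam * L1) \<le> 1"
    and margin: "0 \<le> h1 * h2 - h2\<^sup>2 - 2 * h2 * (\<rho> / (2 * lam))"
begin

definition sample :: "bool \<times> nat \<times> nat \<Rightarrow> 'w \<Rightarrow> 'a \<times> 'b" where
  "sample = (\<lambda>(first_batch, k, i). if first_batch then uhat k i else u k i)"

text \<open>Iterates as functions of an assignment of samples to indices rather than of \<omega>, so
  that dependence on a set of indices and measurability on product spaces can be expressed.\<close>

definition z_of :: "nat \<Rightarrow> (bool \<times> nat \<times> nat \<Rightarrow> 'a \<times> 'b) \<Rightarrow> 'a \<times> 'b" where
  "z_of k x = zoeg_z lam \<mu> f h1 h2 (\<lambda>_. t) (\<lambda>j i. x (True, j, i)) (\<lambda>j i. x (False, j, i)) z0 k"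

definition zhat_of :: "nat \<Rightarrow> (bool \<times> nat \<times> nat \<Rightarrow> 'a \<times> 'b) \<Rightarrow> 'a \<times> 'b" where
  "zhat_of k x = z_of k x - h1 *\<^sub>R batch_oracle lam \<mu> f t (\<lambda>i. x (True, k, i)) (z_of k x)"

definition z :: "nat \<Rightarrow> 'w \<Rightarrow> 'a \<times> 'b" where
  "z k \<omega> = z_of k (\<lambda>p. sample p \<omega>)"

definition zhat :: "nat \<Rightarrow> 'w \<Rightarrow> 'a \<times> 'b" where
  "zhat k \<omega> = zhat_of k (\<lambda>p. sample p \<omega>)"

lemma z_0: "z 0 \<omega> = z0"
  by (simp add: z_def z_of_def)

lemma z_of_Suc:
  "z_of (Suc k) x = z_of k x - h2 *\<^sub>R batch_oracle lam \<mu> f t (\<lambda>i. x (False, k, i)) (zhat_of k x)"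
  by (simp add: z_of_def zhat_of_def extrapolate_def Let_def)

lemma zhat_eq_zoeg_zhat:
  "zhat k \<omega> = zoeg_zhat lam \<mu> f h1 h2 (\<lambda>_. t) (\<lambda>j i. uhat j i \<omega>) (\<lambda>j i. u j i \<omega>) z0 k"
  by (simp add: zhat_def zhat_of_def z_of_def zoeg_zhat_def extrapolate_def sample_def)

lemma batch_oracle_cong:
  "(\<And>i. i \<in> {1..t} \<Longrightarrow> v i = v' i) \<Longrightarrow> batch_oracle lam \<mu> f t v p = batch_oracle lam \<mu> f t v' p"
  by (simp add: batch_oracle_def)

lemma batch_oracle_measurable:
  assumes v: "\<And>i. i \<in> {1..t} \<Longrightarrow> (\<lambda>x. v x i) \<in> borel_measurable Q"
    and [measurable]: "g \<in> borel_measurable Q"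
  shows "(\<lambda>x. batch_oracle lam \<mu> f t (v x) (g x)) \<in> borel_measurable Q"
proof -
  have "(\<lambda>x. zo_oracle lam \<mu> f (g x) (v x i)) \<in> borel_measurable Q" if i: "i \<in> {1..t}" for i
  proof -
    note [measurable] = v[OF i]
    show ?thesis
      unfolding zo_oracle_eq_flip by measurable
  qed
  then show ?thesis
    unfolding batch_oracle_def by (intro borel_measurable_scaleR borel_measurable_sum) auto
qed

text \<open>The samples that determine \<open>z k\<close>: both batches of all iterations strictly
  before \<open>k\<close>.\<close>

definition past :: "nat \<Rightarrow> (bool \<times> nat \<times> nat) set" where
  "past k = UNIV \<times> {..<k} \<times> {1..t}"

lemma z_of_cong: "(\<And>p. p \<in> past k \<Longrightarrow> x p = y p) \<Longrightarrow> z_of k x = z_of k y"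
proof (induction k)
  case 0
  then show ?case by (simp add: z_of_def)
next
  case (Suc k)
  have sub: "x p = y p" if "p \<in> past k \<or> p \<in> UNIV \<times> {k} \<times> {1..t}" for p
    using that by (intro Suc.prems) (auto simp: past_def)
  have "z_of k x = z_of k y"
    using sub by (intro Suc.IH) simp
  moreover have "batch_oracle lam \<mu> f t (\<lambda>i. x (b, k, i)) p = batch_oracle lam \<mu> f t (\<lambda>i. y (b, k, i)) p" for b p
    using sub by (intro batch_oracle_cong) simp
  ultimately show ?case
    by (simp add: z_of_Suc zhat_of_def)
qed

text \<open>\<open>J\<close> stays free because the iterate is read both from the past alone and
  from the past together with the first batch.\<close>

lemma z_of_measurable: "past k \<subseteq> J \<Longrightarrow> z_of k \<in> borel_measurable (PiM J (\<lambda>_. borel))"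
proof (induction k)
  case 0
  have "z_of 0 = (\<lambda>_. z0)"
    by (simp add: z_of_def fun_eq_iff)
  then show ?case by simp
next
  case (Suc k)
  have comp: "(\<lambda>x. x (b, k, i)) \<in> borel_measurable (PiM J (\<lambda>_. borel))" if "i \<in> {1..t}" for b i
    using Suc.prems that by (intro measurable_component_singleton) (auto simp: past_def)
  have "past k \<subseteq> J"
    using Suc.prems by (auto simp: past_def)
  then have IH: "z_of k \<in> borel_measurable (PiM J (\<lambda>_. borel))"
    by (rule Suc.IH)
  then have "zhat_of k \<in> borel_measurable (PiM J (\<lambda>_. borel))"
    unfolding zhat_of_def[abs_def] using comp
    by (intro borel_measurable_diff borel_measurable_scaleR batch_oracle_measurable) auto
  then show ?case
    unfolding z_of_Suc[abs_def] using IH comp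
    by (intro borel_measurable_diff borel_measurable_scaleR batch_oracle_measurable) auto
qed

lemma sample_indep: "indep_vars (\<lambda>_. borel) sample (UNIV \<times> {0..N} \<times> {1..t})"
  using indep by (simp add: sample_def)

lemma sample_batch:
  assumes k: "k \<le> N"
  shows "indep_vars (\<lambda>_. borel) (\<lambda>i. sample (b, k, i)) {1..t}"
    and "i \<in> {1..t} \<Longrightarrow> distr M borel (sample (b, k, i)) = gaussian lam"
proof -
  have "indep_vars (\<lambda>i. PiM {(b, k, i)} (\<lambda>_. borel)) (\<lambda>i \<omega>. restrict (\<lambda>p. sample p \<omega>) {(b, k, i)}) {1..t}"
    using k by (intro indep_vars_restrict[OF sample_indep]) (auto simp: disjoint_family_on_def)
  then have "indep_vars (\<lambda>_. borel)
      (\<lambda>i \<omega>. (restrict (\<lambda>p. sample p \<omega>) {(b, k, i)}) (b, k, i)) {1..t}"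
    by (rule indep_vars_compose2) (auto intro: measurable_component_singleton)
  then show "indep_vars (\<lambda>_. borel) (\<lambda>i. sample (b, k, i)) {1..t}"
    by simp
  show "i \<in> {1..t} \<Longrightarrow> distr M borel (sample (b, k, i)) = gaussian lam"
    using k uhat_law u_law by (simp add: sample_def)
qed

text \<open>The form in which independence of disjoint index blocks is available: an element of the
  product space over \<open>J\<close>, undefined elsewhere.\<close>

definition samples_on :: "(bool \<times> nat \<times> nat) set \<Rightarrow> 'w \<Rightarrow> bool \<times> nat \<times> nat \<Rightarrow> 'a \<times> 'b" where
  "samples_on J \<omega> = restrict (\<lambda>p. sample p \<omega>) J"

definition batch_index :: "bool \<Rightarrow> nat \<Rightarrow> (bool \<times> nat \<times> nat) set" where
  "batch_index b k = {b} \<times> {k} \<times> {1..t}"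

lemma samples_on_indep:
  assumes "A \<inter> B = {}" "A \<subseteq> UNIV \<times> {0..N} \<times> {1..t}" "B \<subseteq> UNIV \<times> {0..N} \<times> {1..t}"
  shows "indep_var (PiM A (\<lambda>_. borel)) (samples_on A) (PiM B (\<lambda>_. borel)) (samples_on B)"
  using indep_var_restrict[OF sample_indep assms] by (simp add: samples_on_def[abs_def])

lemma z_of_samples_on: "past k \<subseteq> J \<Longrightarrow> z_of k (samples_on J \<omega>) = z k \<omega>"
  unfolding z_def by (rule z_of_cong) (auto simp: samples_on_def)

lemma batch_samples_on:
  "batch_index b k \<subseteq> J \<Longrightarrow> batch_oracle lam \<mu> f t (\<lambda>i. samples_on J \<omega> (b, k, i)) p
    = batch_oracle lam \<mu> f t (\<lambda>i. sample (b, k, i) \<omega>) p"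
  by (rule batch_oracle_cong) (simp add: samples_on_def batch_index_def subset_eq)

lemma zhat_of_samples_on:
  "past k \<union> batch_index True k \<subseteq> J \<Longrightarrow> zhat_of k (samples_on J \<omega>) = zhat k \<omega>"
  by (simp add: zhat_of_def zhat_def z_of_samples_on batch_samples_on flip: z_def)

lemma zhat_of_measurable:
  assumes "past k \<union> batch_index True k \<subseteq> J"
  shows "zhat_of k \<in> borel_measurable (PiM J (\<lambda>_. borel))"
proof -
  have z: "z_of k \<in> borel_measurable (PiM J (\<lambda>_. borel))"
    using assms by (intro z_of_measurable) simp
  have "(\<lambda>x. x (True, k, i)) \<in> borel_measurable (PiM J (\<lambda>_. borel))" if "i \<in> {1..t}" for i
    using that assms by (intro measurable_component_singleton) (auto simp: batch_index_def)
  with z show ?thesis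
    unfolding zhat_of_def[abs_def]
    by (intro borel_measurable_diff borel_measurable_scaleR batch_oracle_measurable) auto
qed

lemma samples_on_measurable:
  assumes "J \<subseteq> UNIV \<times> {0..N} \<times> {1..t}"
  shows "samples_on J \<in> measurable M (PiM J (\<lambda>_. borel))"
  using sample_indep assms unfolding samples_on_def[abs_def]
  by (intro measurable_restrict) (auto simp: indep_vars_def)

lemma z_measurable [measurable]:
  assumes "k \<le> Suc N"
  shows "z k \<in> borel_measurable M"
proof -
  \<comment> \<open>\<open>k = Suc N\<close> is admissible, since \<open>past (Suc N)\<close> only
    reaches the sampled iterations 0 to N.\<close>
  have "samples_on (past k) \<in> measurable M (PiM (past k) (\<lambda>_. borel))"
    using assms by (intro samples_on_measurable) (auto simp: past_def)
  from measurable_compose[OF this z_of_measurable[OF order_refl]]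
  show ?thesis
    by (simp add: z_of_samples_on)
qed

lemma zhat_measurable [measurable]:
  assumes "k \<le> N"
  shows "zhat k \<in> borel_measurable M"
proof -
  let ?J = "past k \<union> batch_index True k"
  have "samples_on ?J \<in> measurable M (PiM ?J (\<lambda>_. borel))"
    using assms by (intro samples_on_measurable) (auto simp: past_def batch_index_def)
  from measurable_compose[OF this zhat_of_measurable[OF order_refl]]
  show ?thesis
    by (simp add: zhat_of_samples_on)
qed

section \<open>Expected decrease and summation over the steps\<close>

definition s2 :: real where "s2 = lam * \<sigma>\<^sup>2 / real t"

definition bias :: real where "bias = \<mu>\<^sup>2 * L1 * DIM('a \<times> 'b) * (1 + \<rho> * L1 / 2)"

text \<open>The coefficient of |\<Phi>(y)|^2 in \<open>extragradient_pointwise\<close> for \<kappa>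
  = \<rho> / (2 lam).\<close>

definition gain :: real where "gain = h1 * h2 - h2\<^sup>2 - 2 * h2 * (\<rho> / (2 * lam))"

text \<open>The error of one step: defect of the averaged Minty inequality, noise of the first
  batch, noise of the second.\<close>

definition loss :: real where "loss = 2 * h2 * bias + 3 * h1 * h2 * s2 + h2\<^sup>2 * s2"

lemma s2_nonneg: "s2 \<ge> 0" and bias_nonneg: "bias \<ge> 0" and gain_nonneg: "gain \<ge> 0"
  using lam L1 rho margin by (auto simp: s2_def bias_def gain_def)

lemma loss_nonneg: "loss \<ge> 0"
  using h s2_nonneg bias_nonneg by (simp add: loss_def)

text \<open>The batches are averaged in reverse order of use: the second with the past and the first
  batch frozen, then the first with the past frozen. Each time the evaluation point is
  constant.\<close>

lemma expected_step:
  assumes k: "k \<le> N"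
  shows "(\<integral>\<^sup>+\<omega>. ennreal ((norm (z (Suc k) \<omega> - zs))\<^sup>2 + gain * (norm (mean_oracle (zhat k \<omega>)))\<^sup>2) \<partial>M)
    \<le> (\<integral>\<^sup>+\<omega>. ennreal ((norm (z k \<omega> - zs))\<^sup>2) \<partial>M) + ennreal loss"
proof -
  define B where "B b p \<omega> = batch_oracle lam \<mu> f t (\<lambda>i. sample (b, k, i) \<omega>) p" for b p \<omega>
  have moments: "B b p \<in> borel_measurable M" "integrable M (\<lambda>\<omega>. (norm (B b p \<omega>))\<^sup>2)"
      "expectation (B b p) = mean_oracle p"
      "expectation (\<lambda>\<omega>. (norm (B b p \<omega> - mean_oracle p))\<^sup>2) \<le> s2" for b p
    using batch_oracle_moments[OF prob_space_axioms t sample_batch[OF k] variance, of b p]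
    unfolding B_def s2_def by blast+
  let ?F = "batch_index False k" and ?T = "batch_index True k"
  let ?I = "past k \<union> ?T"
  let ?P = "\<lambda>J. PiM J (\<lambda>_. borel :: ('a \<times> 'b) measure)"
  define g where "g = (\<lambda>(x, y). ennreal
      ((norm (z_of k x - h2 *\<^sub>R batch_oracle lam \<mu> f t (\<lambda>i. y (False, k, i)) (zhat_of k x) - zs))\<^sup>2
        + gain * (norm (mean_oracle (zhat_of k x)))\<^sup>2))"
  \<comment> \<open>The same point as \<open>zhat_of\<close>, but as a function of the pair (past,
    first batch), which the second use of Fubini requires.\<close>
  define q where "q = (\<lambda>(x, y). z_of k x - h1 *\<^sub>R batch_oracle lam \<mu> f t (\<lambda>i. y (True, k, i)) (z_of k x))"
  \<comment> \<open>What bounds the integrand once the second batch is averaged out; its noise is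
    kept as \<open>h2\<^sup>2 * s2\<close>.\<close>
  define g' where "g' = (\<lambda>(x, y). ennreal ((norm (z_of k x - h2 *\<^sub>R mean_oracle (q (x, y)) - zs))\<^sup>2
        + gain * (norm (mean_oracle (q (x, y))))\<^sup>2 + h2\<^sup>2 * s2))"
  have comp: "(\<lambda>x. snd x (b, k, i)) \<in> borel_measurable (Q \<Otimes>\<^sub>M ?P (batch_index b k))"
    if "i \<in> {1..t}" for b i and Q :: "(bool \<times> nat \<times> nat \<Rightarrow> 'a \<times> 'b) measure"
    using that by (intro measurable_compose[OF measurable_snd measurable_component_singleton])
      (simp add: batch_index_def)
  have [measurable]: "z_of k \<in> borel_measurable (?P ?I)" "z_of k \<in> borel_measurable (?P (past k))"
      "zhat_of k \<in> borel_measurable (?P ?I)"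
    by (intro z_of_measurable zhat_of_measurable; simp)+
  have [measurable]: "(\<lambda>x. batch_oracle lam \<mu> f t (\<lambda>i. snd x (False, k, i)) (zhat_of k (fst x)))
      \<in> borel_measurable (?P ?I \<Otimes>\<^sub>M ?P ?F)"
    by (rule batch_oracle_measurable[OF comp]) measurable
  have g_meas: "g \<in> borel_measurable (?P ?I \<Otimes>\<^sub>M ?P ?F)"
    unfolding g_def case_prod_beta by measurable
  have [measurable]: "(\<lambda>x. batch_oracle lam \<mu> f t (\<lambda>i. snd x (True, k, i)) (z_of k (fst x)))
      \<in> borel_measurable (?P (past k) \<Otimes>\<^sub>M ?P ?T)"
    by (rule batch_oracle_measurable[OF comp]) measurable
  have [measurable]: "q \<in> borel_measurable (?P (past k) \<Otimes>\<^sub>M ?P ?T)"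
    unfolding q_def case_prod_beta by measurable
  have g'_meas: "g' \<in> borel_measurable (?P (past k) \<Otimes>\<^sub>M ?P ?T)"
    unfolding g'_def case_prod_beta by measurable
  have q_eq: "q (samples_on (past k) \<omega>, samples_on ?T \<omega>')
      = z k \<omega> - h1 *\<^sub>R B True (z k \<omega>) \<omega>'" for \<omega> \<omega>'
    by (simp add: q_def z_of_samples_on batch_samples_on B_def)
  have zhat_eq: "zhat k \<omega> = z k \<omega> - h1 *\<^sub>R B True (z k \<omega>) \<omega>" for \<omega>
    by (simp add: zhat_def zhat_of_def z_def B_def)
  have z_Suc: "z (Suc k) \<omega> = z k \<omega> - h2 *\<^sub>R B False (zhat k \<omega>) \<omega>" for \<omega>
    by (simp add: z_def z_of_Suc zhat_def B_def)
  have "(\<integral>\<^sup>+\<omega>. ennreal ((norm (z (Suc k) \<omega> - zs))\<^sup>2 + gain * (norm (mean_oracle (zhat k \<omega>)))\<^sup>2) \<partial>M)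
      = (\<integral>\<^sup>+\<omega>. g (samples_on ?I \<omega>, samples_on ?F \<omega>) \<partial>M)"
    by (simp add: g_def z_of_samples_on zhat_of_samples_on batch_samples_on z_Suc flip: B_def)
  also have "\<dots> = (\<integral>\<^sup>+\<omega>. (\<integral>\<^sup>+\<omega>'. g (samples_on ?I \<omega>, samples_on ?F \<omega>') \<partial>M) \<partial>M)"
    using k by (intro nn_integral_indep_var[OF samples_on_indep g_meas])
      (auto simp: past_def batch_index_def)
  also have "\<dots> \<le> (\<integral>\<^sup>+\<omega>. g' (samples_on (past k) \<omega>, samples_on ?T \<omega>) \<partial>M)"
  proof (rule nn_integral_mono)
    fix \<omega>
    show "(\<integral>\<^sup>+\<omega>'. g (samples_on ?I \<omega>, samples_on ?F \<omega>') \<partial>M) \<le> g' (samples_on (past k) \<omega>, samples_on ?T \<omega>)"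
      using nn_integral_noisy_step[OF moments[of False "zhat k \<omega>"],
          of "gain * (norm (mean_oracle (zhat k \<omega>)))\<^sup>2" "z k \<omega>" h2 zs] gain_nonneg
      by (simp add: g_def g'_def q_eq z_of_samples_on zhat_of_samples_on batch_samples_on
          flip: zhat_eq B_def)
  qed
  also have "\<dots> = (\<integral>\<^sup>+\<omega>. (\<integral>\<^sup>+\<omega>'. g' (samples_on (past k) \<omega>, samples_on ?T \<omega>') \<partial>M) \<partial>M)"
    using k by (intro nn_integral_indep_var[OF samples_on_indep g'_meas])
      (auto simp: past_def batch_index_def)
  also have "\<dots> \<le> (\<integral>\<^sup>+\<omega>. ennreal ((norm (z k \<omega> - zs))\<^sup>2 + loss) \<partial>M)"
  proof (rule nn_integral_mono)
    fix \<omega>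
    have "0 \<le> lam * L1" "0 \<le> h2\<^sup>2 * s2"
      using lam L1 s2_nonneg by auto
    from extragradient_extrapolation[OF h this(1) mean_oracle_Lipschitz
        mean_oracle_weak_Minty[OF rho weak_Minty] moments[of True "z k \<omega>"] margin this(2)]
    show "(\<integral>\<^sup>+\<omega>'. g' (samples_on (past k) \<omega>, samples_on ?T \<omega>') \<partial>M) \<le> ennreal ((norm (z k \<omega> - zs))\<^sup>2 + loss)"
      by (simp add: g'_def q_eq z_of_samples_on gain_def loss_def bias_def add_ac)
  qed
  also have "\<dots> = (\<integral>\<^sup>+\<omega>. ennreal ((norm (z k \<omega> - zs))\<^sup>2) \<partial>M) + ennreal loss"
    using k loss_nonneg by (simp add: nn_integral_add emeasure_space_1)
  finally show ?thesis .
qed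

text \<open>To avoid subtraction in \<open>ennreal\<close>, the gains collected so far stay on the
  left beside the current distance; each step adds one gain there and one loss on the right.\<close>

lemma telescoped:
  assumes "k \<le> Suc N"
  shows "(\<integral>\<^sup>+\<omega>. ennreal ((norm (z k \<omega> - zs))\<^sup>2) \<partial>M)
      + (\<Sum>j<k. \<integral>\<^sup>+\<omega>. ennreal (gain * (norm (mean_oracle (zhat j \<omega>)))\<^sup>2) \<partial>M)
    \<le> ennreal ((norm (z0 - zs))\<^sup>2 + real k * loss)"
  using assms
proof (induction k)
  case 0
  then show ?case
    by (simp add: z_0 emeasure_space_1)
next
  case (Suc k)
  then have k: "k \<le> N" by simp
  have zk: "z (Suc k) \<in> borel_measurable M"
    using Suc.prems by (rule z_measurable)
  let ?D = "\<lambda>k. \<integral>\<^sup>+\<omega>. ennreal ((norm (z k \<omega> - zs))\<^sup>2) \<partial>M"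
  let ?G = "\<lambda>j. \<integral>\<^sup>+\<omega>. ennreal (gain * (norm (mean_oracle (zhat j \<omega>)))\<^sup>2) \<partial>M"
  have "?D (Suc k) + ?G k \<le> ?D k + ennreal loss"
    using expected_step[OF k] zk k gain_nonneg by (simp add: nn_integral_add)
  from add_right_mono[OF this, of "\<Sum>j<k. ?G j"]
  have "?D (Suc k) + (\<Sum>j<Suc k. ?G j) \<le> ?D k + ennreal loss + (\<Sum>j<k. ?G j)"
    by (simp only: sum.lessThan_Suc add_ac)
  also have "\<dots> = ?D k + (\<Sum>j<k. ?G j) + ennreal loss"
    by (simp only: add_ac)
  also have "\<dots> \<le> ennreal ((norm (z0 - zs))\<^sup>2 + real k * loss) + ennreal loss"
    using Suc by (intro add_right_mono) simp
  also have "\<dots> = ennreal ((norm (z0 - zs))\<^sup>2 + real (Suc k) * loss)"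
    using loss_nonneg by (simp add: algebra_simps flip: ennreal_plus)
  finally show ?case .
qed

text \<open>Integrability emerges here: the total of the gains is finite, hence each nonnegative
  integral is, and the passage to Bochner integrals becomes legitimate.\<close>

lemma mean_oracle_sum_bound:
  assumes gain: "gain > 0"
  shows "\<forall>k\<in>{0..N}. integrable M (\<lambda>\<omega>. (norm (mean_oracle (zhat k \<omega>)))\<^sup>2)"
    and "gain * (\<Sum>k=0..N. expectation (\<lambda>\<omega>. (norm (mean_oracle (zhat k \<omega>)))\<^sup>2))
      \<le> (norm (z0 - zs))\<^sup>2 + (real N + 1) * loss"
proof -
  let ?g = "\<lambda>j \<omega>. gain * (norm (mean_oracle (zhat j \<omega>)))\<^sup>2"
  have sets: "{..<Suc N} = {0..N}"
    by auto
  have "(\<Sum>j<Suc N. \<integral>\<^sup>+\<omega>. ennreal (?g j \<omega>) \<partial>M)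
      \<le> (\<integral>\<^sup>+\<omega>. ennreal ((norm (z (Suc N) \<omega> - zs))\<^sup>2) \<partial>M) + (\<Sum>j<Suc N. \<integral>\<^sup>+\<omega>. ennreal (?g j \<omega>) \<partial>M)"
    by simp
  also have "\<dots> \<le> ennreal ((norm (z0 - zs))\<^sup>2 + real (Suc N) * loss)"
    by (rule telescoped) simp
  finally have total: "(\<Sum>j=0..N. \<integral>\<^sup>+\<omega>. ennreal (?g j \<omega>) \<partial>M) \<le> ennreal ((norm (z0 - zs))\<^sup>2 + (real N + 1) * loss)"
    unfolding sets by (simp add: add.commute)
  have int: "integrable M (?g j)" if j: "j \<in> {0..N}" for j
  proof (rule integrableI_nonneg)
    show "?g j \<in> borel_measurable M"
      using j by simp
    have "(\<integral>\<^sup>+\<omega>. ennreal (?g j \<omega>) \<partial>M) \<le> (\<Sum>j=0..N. \<integral>\<^sup>+\<omega>. ennreal (?g j \<omega>) \<partial>M)"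
      using j by (intro member_le_sum) auto
    also note total
    finally show "(\<integral>\<^sup>+\<omega>. ennreal (?g j \<omega>) \<partial>M) < \<infinity>"
      by (simp add: le_less_trans)
  qed (use gain in auto)
  then show "\<forall>k\<in>{0..N}. integrable M (\<lambda>\<omega>. (norm (mean_oracle (zhat k \<omega>)))\<^sup>2)"
    using gain by simp
  have "ennreal (\<Sum>j=0..N. expectation (?g j)) = (\<Sum>j=0..N. ennreal (expectation (?g j)))"
    using gain by (intro sum_ennreal[symmetric]) simp
  also have "\<dots> = (\<Sum>j=0..N. \<integral>\<^sup>+\<omega>. ennreal (?g j \<omega>) \<partial>M)"
    using gain int by (intro sum.cong refl nn_integral_eq_integral[symmetric]) auto
  also note total
  finally have "(\<Sum>j=0..N. expectation (?g j)) \<le> (norm (z0 - zs))\<^sup>2 + (real N + 1) * loss"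
    by (subst (asm) ennreal_le_iff) (use loss_nonneg in simp_all)
  then show "gain * (\<Sum>k=0..N. expectation (\<lambda>\<omega>. (norm (mean_oracle (zhat k \<omega>)))\<^sup>2))
      \<le> (norm (z0 - zs))\<^sup>2 + (real N + 1) * loss"
    by (simp add: sum_distrib_left)
qed

text \<open>The return from \<Phi> to F: |F|^2 <= 2 |\<Phi>|^2 + 2 |\<Phi> - F|^2, where the bias is
  bounded uniformly in the point.\<close>

lemma saddle_sum_bound:
  assumes gain: "gain > 0"
  shows "\<forall>k\<in>{0..N}. integrable M (\<lambda>\<omega>. (norm (saddle_op f (zhat k \<omega>)))\<^sup>2)"
    and "1 / (real N + 1) * (\<Sum>k=0..N. expectation (\<lambda>\<omega>. (norm (saddle_op f (zhat k \<omega>)))\<^sup>2))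
      \<le> 2 * (((norm (z0 - zs))\<^sup>2 / (real N + 1) + loss) / gain) + 2 * (lam * L1\<^sup>2 * \<mu>\<^sup>2 * DIM('a \<times> 'b))"
proof -
  define b where "b = lam * L1\<^sup>2 * \<mu>\<^sup>2 * DIM('a \<times> 'b)"
  define E where "E = (\<Sum>k=0..N. expectation (\<lambda>\<omega>. (norm (mean_oracle (zhat k \<omega>)))\<^sup>2))"
  have le: "(norm (saddle_op f p))\<^sup>2 \<le> 2 * (norm (mean_oracle p))\<^sup>2 + 2 * b" for p
  proof -
    have "norm (saddle_op f p) \<le> norm (mean_oracle p) + norm (mean_oracle p - saddle_op f p)"
      using norm_triangle_sub[of "saddle_op f p" "mean_oracle p"]
      by (simp only: norm_minus_commute)
    then have "(norm (saddle_op f p))\<^sup>2 \<le> (norm (mean_oracle p) + norm (mean_oracle p - saddle_op f p))\<^sup>2"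
      by (rule power_mono) simp
    also have "\<dots> \<le> 2 * (norm (mean_oracle p))\<^sup>2 + 2 * (norm (mean_oracle p - saddle_op f p))\<^sup>2"
      using sum_squares_bound[of "norm (mean_oracle p)" "norm (mean_oracle p - saddle_op f p)"]
      by (simp add: power2_sum)
    finally show ?thesis
      using mean_oracle_bias[of p] by (simp add: b_def)
  qed
  note bound = mean_oracle_sum_bound[OF gain]
  have int: "integrable M (\<lambda>\<omega>. (norm (saddle_op f (zhat k \<omega>)))\<^sup>2)" if k: "k \<in> {0..N}" for k
  proof (rule Bochner_Integration.integrable_bound)
    show "integrable M (\<lambda>\<omega>. 2 * (norm (mean_oracle (zhat k \<omega>)))\<^sup>2 + 2 * b)"
      using bound(1) k by simp
    show "AE \<omega> in M. norm ((norm (saddle_op f (zhat k \<omega>)))\<^sup>2) \<le> norm (2 * (norm (mean_oracle (zhat k \<omega>)))\<^sup>2 + 2 * b)"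
      using le by (intro AE_I2) (smt (verit) real_norm_def zero_le_power2)
    show "(\<lambda>\<omega>. (norm (saddle_op f (zhat k \<omega>)))\<^sup>2) \<in> borel_measurable M"
      using k by simp
  qed
  then show "\<forall>k\<in>{0..N}. integrable M (\<lambda>\<omega>. (norm (saddle_op f (zhat k \<omega>)))\<^sup>2)"
    by blast
  have "(\<Sum>k=0..N. expectation (\<lambda>\<omega>. (norm (saddle_op f (zhat k \<omega>)))\<^sup>2))
      \<le> (\<Sum>k=0..N. 2 * expectation (\<lambda>\<omega>. (norm (mean_oracle (zhat k \<omega>)))\<^sup>2) + 2 * b)"
  proof (rule sum_mono)
    fix k assume k: "k \<in> {0..N}"
    have "expectation (\<lambda>\<omega>. (norm (saddle_op f (zhat k \<omega>)))\<^sup>2)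
        \<le> expectation (\<lambda>\<omega>. 2 * (norm (mean_oracle (zhat k \<omega>)))\<^sup>2 + 2 * b)"
      using int k bound(1) le by (intro integral_mono) auto
    also have "\<dots> = 2 * expectation (\<lambda>\<omega>. (norm (mean_oracle (zhat k \<omega>)))\<^sup>2) + 2 * b"
      using bound(1) k by (simp add: prob_space)
    finally show "expectation (\<lambda>\<omega>. (norm (saddle_op f (zhat k \<omega>)))\<^sup>2)
        \<le> 2 * expectation (\<lambda>\<omega>. (norm (mean_oracle (zhat k \<omega>)))\<^sup>2) + 2 * b" .
  qed
  also have "\<dots> = 2 * E + 2 * b * (real N + 1)"
    by (simp add: E_def sum.distrib sum_distrib_left algebra_simps)
  also have "E \<le> ((norm (z0 - zs))\<^sup>2 + (real N + 1) * loss) / gain"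
    using bound(2) gain by (simp add: E_def pos_le_divide_eq mult.commute)
  finally have "1 / (real N + 1) * (\<Sum>k=0..N. expectation (\<lambda>\<omega>. (norm (saddle_op f (zhat k \<omega>)))\<^sup>2))
      \<le> 1 / (real N + 1) * (2 * (((norm (z0 - zs))\<^sup>2 + (real N + 1) * loss) / gain) + 2 * b * (real N + 1))"
    by (intro mult_left_mono) auto
  also have "\<dots> = 2 * (((norm (z0 - zs))\<^sup>2 / (real N + 1) + loss) / gain) + 2 * b"
  proof -
    have "1 / n * (2 * ((r + n * loss) / gain) + 2 * b * n) = 2 * ((r / n + loss) / gain) + 2 * b"
      if "n > 0" for n r :: real
      using that gain by (simp add: field_simps)
    then show ?thesis
      by simp
  qed
  finally show "1 / (real N + 1) * (\<Sum>k=0..N. expectation (\<lambda>\<omega>. (norm (saddle_op f (zhat k \<omega>)))\<^sup>2))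
      \<le> 2 * (((norm (z0 - zs))\<^sup>2 / (real N + 1) + loss) / gain) + 2 * (lam * L1\<^sup>2 * \<mu>\<^sup>2 * DIM('a \<times> 'b))"
    by (simp add: b_def)
qed

end

subsection \<open>Choice of the parameters\<close>

text \<open>A budget with \<eta> = \<epsilon>^2. In units of \<open>\<eta> * gain\<close> the
  initial distance takes 1/9, the Minty defect 17/288 and the noise 28/216; the return from \<Phi>
  to F takes \<eta> / 96. Twice the sum of these shares is about 0.62.\<close>

lemma step_size_bounds:
  fixes lam L1 \<mu> \<sigma> \<rho> h1 h2 \<epsilon> r0 d t n :: real
  assumes lam: "lam > 0" and L1: "L1 > 0" and rho: "0 \<le> \<rho>" "\<rho> < 1 / (8 * L1)"
    and h2: "h2 > 0" "h2 \<le> h1 / 2" and h1: "h1 \<le> 1 / (L1 * lam)"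
    and c: "0 < lam\<^sup>2 * L1 * h2\<^sup>2 - 2 * \<rho>" and eps: "\<epsilon> > 0" and d: "d > 0" and t: "t > 0" and n: "n > 0"
    and t_ge: "18 * lam * \<sigma>\<^sup>2 / (L1 * (lam\<^sup>2 * L1 * h2\<^sup>2 - 2 * \<rho>)) / \<epsilon>\<^sup>2 \<le> t"
    and n_ge: "12 * lam\<^sup>2 * L1 * r0\<^sup>2 / (lam\<^sup>2 * L1 * h2\<^sup>2 - 2 * \<rho>) / \<epsilon>\<^sup>2 \<le> n"
    and mu: "24 * lam * L1 * d * \<mu>\<^sup>2 \<le> (lam\<^sup>2 * L1 * h2\<^sup>2 - 2 * \<rho>) * \<epsilon>\<^sup>2"
  defines "gain \<equiv> h1 * h2 - h2\<^sup>2 - 2 * h2 * (\<rho> / (2 * lam))"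
    and "s2 \<equiv> lam * \<sigma>\<^sup>2 / t"
    and "bias \<equiv> \<mu>\<^sup>2 * L1 * d * (1 + \<rho> * L1 / 2)"
  shows "gain > 0"
    and "2 * ((r0\<^sup>2 / n + (2 * h2 * bias + 3 * h1 * h2 * s2 + h2\<^sup>2 * s2)) / gain)
      + 2 * (lam * L1\<^sup>2 * \<mu>\<^sup>2 * d) \<le> \<epsilon>\<^sup>2"
proof -
  define c where "c = lam\<^sup>2 * L1 * h2\<^sup>2 - 2 * \<rho>"
  define K where "K = lam * L1"
  define \<eta> where "\<eta> = \<epsilon>\<^sup>2"
  have pos: "c > 0" "K > 0" "\<eta> > 0"
    using c lam L1 eps by (simp_all add: c_def K_def \<eta>_def)
  have "K * h1 \<le> 1"
    using h1 lam L1 by (simp add: K_def field_simps)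
  moreover have "K * (2 * h2) \<le> K * h1"
    using pos h2 by (intro mult_left_mono) auto
  ultimately have Kh2: "K * h2 \<le> 1 / 2"
    by simp
  have c_le: "c \<le> lam * K * h2\<^sup>2"
    using rho by (simp add: c_def K_def power2_eq_square)
  have hh: "h2\<^sup>2 \<le> h1 * h2 / 2"
    using mult_right_mono[OF h2(2), of h2] h2(1) by (simp add: power2_eq_square)
  \<comment> \<open>Positivity of \<open>c\<close> means \<rho> < lam K h2^2 / 2, and K h2 <=
    1/2.\<close>
  have rho_le: "\<rho> / lam \<le> h2 / 4"
  proof -
    have "\<rho> / lam \<le> (lam * K * h2\<^sup>2 / 2) / lam"
      using pos(1) lam by (intro divide_right_mono) (simp_all add: c_def K_def power2_eq_square)
    also have "\<dots> = (K * h2) * (h2 / 2)"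
      using lam by (simp add: power2_eq_square)
    also have "\<dots> \<le> 1 / 2 * (h2 / 2)"
      using Kh2 h2 by (intro mult_right_mono) auto
    finally show ?thesis by simp
  qed
  have "h2 * (\<rho> / lam) \<le> h2\<^sup>2 / 4"
    using mult_left_mono[OF rho_le, of h2] h2 by (simp add: power2_eq_square)
  \<comment> \<open>With h2^2 <= h1 h2 / 2 the first bound is 2 - 1 - 1/4 = 3/4 in units of h2^2,
    the second 1 - (1 + 1/4) / 2 = 3/8 in units of h1 h2.\<close>
  then have gain1: "gain \<ge> 3 / 4 * h2\<^sup>2" and gain2: "gain \<ge> 3 / 8 * (h1 * h2)"
    using hh by (simp_all add: gain_def)
  have "h2\<^sup>2 > 0"
    using h2 by simp
  with gain1 show gain: "gain > 0"
    by linarith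
  have T1: "r0\<^sup>2 / n \<le> 1 / 9 * \<eta> * gain"
  proof -
    have "12 * (lam * K) * r0\<^sup>2 \<le> n * (c * \<eta>)"
      using n_ge[folded c_def \<eta>_def] pos by (simp add: K_def field_simps power2_eq_square)
    also have "\<dots> \<le> n * (lam * K * h2\<^sup>2 * \<eta>)"
      using c_le pos n by (intro mult_left_mono mult_right_mono) auto
    finally have "(lam * K) * (12 * r0\<^sup>2) \<le> (lam * K) * (n * (h2\<^sup>2 * \<eta>))"
      by (simp add: mult_ac)
    then have "12 * r0\<^sup>2 \<le> n * (h2\<^sup>2 * \<eta>)"
      using lam pos by (simp add: mult_le_cancel_left)
    then have "r0\<^sup>2 / n \<le> 1 / 9 * \<eta> * (3 / 4 * h2\<^sup>2)"
      using n by (simp add: field_simps)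
    also have "\<dots> \<le> 1 / 9 * \<eta> * gain"
      using gain1 pos by (intro mult_left_mono) auto
    finally show ?thesis .
  qed
  have mu': "\<mu>\<^sup>2 * L1 * d \<le> K * h2\<^sup>2 * \<eta> / 24"
  proof -
    have "24 * lam * L1 * d * \<mu>\<^sup>2 \<le> c * \<eta>"
      using mu by (simp add: c_def \<eta>_def)
    also have "\<dots> \<le> lam * K * h2\<^sup>2 * \<eta>"
      using c_le pos by (intro mult_right_mono) auto
    finally have "lam * (24 * (\<mu>\<^sup>2 * L1 * d)) \<le> lam * (K * h2\<^sup>2 * \<eta>)"
      by (simp add: mult_ac)
    then show ?thesis
      using lam by (simp add: mult_le_cancel_left)
  qed
  have T2: "2 * h2 * bias \<le> 17 / 288 * \<eta> * gain"
  proof -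
    have "\<rho> * (8 * L1) < 1"
      using rho(2) L1 by (simp add: pos_less_divide_eq)
    \<comment> \<open>The 1/16 is half of the bound 1/8 on \<rho> L1.\<close>
    then have "1 + \<rho> * L1 / 2 \<le> 17 / 16"
      by (simp add: mult_ac)
    then have "bias \<le> (K * h2\<^sup>2 * \<eta> / 24) * (17 / 16)"
      unfolding bias_def using rho pos L1 by (intro mult_mono mu') simp_all
    then have "2 * h2 * bias \<le> 2 * h2 * ((K * h2\<^sup>2 * \<eta> / 24) * (17 / 16))"
      using h2 by (intro mult_left_mono) auto
    also have "\<dots> = (K * h2) * (17 / 192 * h2\<^sup>2 * \<eta>)"
      by simp
    also have "\<dots> \<le> 1 / 2 * (17 / 192 * h2\<^sup>2 * \<eta>)"
      using Kh2 pos by (intro mult_right_mono) auto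
    also have "\<dots> = 17 / 288 * \<eta> * (3 / 4 * h2\<^sup>2)"
      by simp
    also have "\<dots> \<le> 17 / 288 * \<eta> * gain"
      using gain1 pos by (intro mult_left_mono) auto
    finally show ?thesis .
  qed
  have Kh2_sq: "K\<^sup>2 * h2\<^sup>2 \<le> 1 / 4"
    using power_mono[OF Kh2, of 2] pos h2 by (simp add: power_mult_distrib power_divide)
  have T3: "3 * h1 * h2 * s2 + h2\<^sup>2 * s2 \<le> 28 / 216 * \<eta> * gain"
  proof -
    have "18 * (lam * \<sigma>\<^sup>2) \<le> t * (L1 * (c * \<eta>))"
      using t_ge[folded c_def \<eta>_def] pos L1 by (simp add: field_simps)
    also have "\<dots> \<le> t * (L1 * (lam * K * h2\<^sup>2 * \<eta>))"
      using c_le pos t L1 by (intro mult_left_mono mult_right_mono) auto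
    also have "\<dots> = t * ((K\<^sup>2 * h2\<^sup>2) * \<eta>)"
      by (simp add: K_def power2_eq_square)
    also have "\<dots> \<le> t * (1 / 4 * \<eta>)"
      using Kh2_sq pos t by (intro mult_left_mono mult_right_mono) auto
    finally have s2: "s2 \<le> \<eta> / 72"
      using t by (simp add: s2_def field_simps)
    have "s2 \<ge> 0"
      using lam t by (simp add: s2_def)
    \<comment> \<open>7/2 = 3 + 1/2, the half coming from h2^2 <= h1 h2 / 2.\<close>
    then have "3 * h1 * h2 * s2 + h2\<^sup>2 * s2 \<le> 7 / 2 * (h1 * h2) * s2"
      using mult_right_mono[OF hh, of s2] by simp
    also have "\<dots> \<le> 7 / 2 * (h1 * h2) * (\<eta> / 72)"
      using s2 h2 by (intro mult_left_mono) auto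
    also have "\<dots> = 28 / 216 * \<eta> * (3 / 8 * (h1 * h2))"
      by simp
    also have "\<dots> \<le> 28 / 216 * \<eta> * gain"
      using gain2 pos by (intro mult_left_mono) auto
    finally show ?thesis .
  qed
  have T4: "lam * L1\<^sup>2 * \<mu>\<^sup>2 * d \<le> \<eta> / 96"
  proof -
    have "lam * L1\<^sup>2 * \<mu>\<^sup>2 * d = K * (\<mu>\<^sup>2 * L1 * d)"
      by (simp add: K_def power2_eq_square)
    also have "\<dots> \<le> K * (K * h2\<^sup>2 * \<eta> / 24)"
      using mu' pos by (intro mult_left_mono) auto
    also have "\<dots> = (K\<^sup>2 * h2\<^sup>2) * (\<eta> / 24)"
      by (simp add: power2_eq_square)
    also have "\<dots> \<le> 1 / 4 * (\<eta> / 24)"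
      using Kh2_sq pos by (intro mult_right_mono) auto
    finally show ?thesis by simp
  qed
  have combine: "2 * X + 2 * Y \<le> \<epsilon>\<^sup>2"
    if "X \<le> (1 / 9 + 17 / 288 + 28 / 216) * \<eta>" "Y \<le> \<eta> / 96" for X Y
    using that pos(3) unfolding \<eta>_def[symmetric] by simp
  have "r0\<^sup>2 / n + (2 * h2 * bias + 3 * h1 * h2 * s2 + h2\<^sup>2 * s2) \<le> (1 / 9 + 17 / 288 + 28 / 216) * \<eta> * gain"
    using add_mono[OF T1 add_mono[OF T2 T3]] by (simp only: distrib_right add.assoc)
  then have "(r0\<^sup>2 / n + (2 * h2 * bias + 3 * h1 * h2 * s2 + h2\<^sup>2 * s2)) / gain \<le> (1 / 9 + 17 / 288 + 28 / 216) * \<eta>"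
    using gain by (simp add: pos_divide_le_eq)
  then show "2 * ((r0\<^sup>2 / n + (2 * h2 * bias + 3 * h1 * h2 * s2 + h2\<^sup>2 * s2)) / gain)
      + 2 * (lam * L1\<^sup>2 * \<mu>\<^sup>2 * d) \<le> \<epsilon>\<^sup>2"
    using T4 by (rule combine)
qed

text \<open>Integrability is asserted beside the bound because the Bochner integral of a
  non-integrable function is 0 by convention, which would make the bound alone too weak.\<close>

theorem corollary4:
  fixes f :: "(real^'n) \<times> (real^'m) \<Rightarrow> real"
    and z0 zs :: "(real^'n) \<times> (real^'m)"
    and lam L1 \<mu> \<sigma> \<rho> h1 h2 \<epsilon> r0 :: real
    and d t N :: nat
    and M :: "'w measure"
    and uhat u :: "nat \<Rightarrow> nat \<Rightarrow> 'w \<Rightarrow> (real^'n) \<times> (real^'m)"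
    and zhat :: "nat \<Rightarrow> 'w \<Rightarrow> (real^'n) \<times> (real^'m)"
  assumes d: "d = CARD('n) + CARD('m)"
    and lam: "lam > 0"
    and f_diff: "\<And>z. f differentiable (at z)"
    and f_C1: "continuous_on UNIV (grad f)"
    and L1: "L1 > 0"
    and f_Lip: "\<And>z1 z2. B_dual_norm lam (grad f z1 - grad f z2) \<le> L1 * B_norm lam (z1 - z2)"
    and mu: "\<mu> > 0"
    and sigma: "\<sigma> \<ge> 0"
    and variance: "\<And>z. (\<integral>v. (B_dual_norm lam
            (zo_oracle lam \<mu> f z v - saddle_op (smoothing lam \<mu> f) z))\<^sup>2 \<partial>gaussian lam) \<le> \<sigma>\<^sup>2"
    and rho: "\<rho> \<in> {0..<1 / (8 * L1)}"
    and weak_Minty: "\<And>z. saddle_op f z \<bullet> (z - zs) + \<rho> / 2 * (B_dual_norm lam (saddle_op f z))\<^sup>2 \<ge> 0"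
    and prob: "prob_space M"
    and indep: "prob_space.indep_vars M (\<lambda>_. borel)
            (\<lambda>(first_batch, k, i). if first_batch then uhat k i else u k i)
            ((UNIV :: bool set) \<times> {0..N} \<times> {1..t})"
    and uhat_law: "\<And>k i. k \<in> {0..N} \<Longrightarrow> i \<in> {1..t} \<Longrightarrow> distr M borel (uhat k i) = gaussian lam"
    and u_law: "\<And>k i. k \<in> {0..N} \<Longrightarrow> i \<in> {1..t} \<Longrightarrow> distr M borel (u k i) = gaussian lam"
    and zhat: "\<And>k \<omega>. zhat k \<omega> =
            zoeg_zhat lam \<mu> f h1 h2 (\<lambda>_. t) (\<lambda>j i. uhat j i \<omega>) (\<lambda>j i. u j i \<omega>) z0 k"
    and t_ge_1: "t \<ge> 1"
    and h1: "h1 > 0" "h1 \<le> 1 / (L1 * lam)"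
    and h2: "h2 > 0" "h2 \<in> {sqrt (2 * \<rho> / (L1 * lam\<^sup>2))<..h1 / 2}"
    and r0: "r0 = norm (z0 - zs)"
    and eps: "\<epsilon> > 0"
    and t_ge: "int t \<ge> \<lceil>18 * lam * \<sigma>\<^sup>2 / (L1 * (lam\<^sup>2 * L1 * h2\<^sup>2 - 2 * \<rho>)) * \<epsilon> powi (-2)\<rceil>"
    and N_ge: "int N \<ge> \<lceil>(12 * lam\<^sup>2 * L1 * r0\<^sup>2 / (lam\<^sup>2 * L1 * h2\<^sup>2 - 2 * \<rho>)) * \<epsilon> powi (-2) - 1\<rceil>"
    and mu_le: "\<mu> \<le> min
            (\<epsilon> / (sqrt 3 * lam * L1 * (real d + 3) powr (3 / 2)))
            (sqrt ((lam\<^sup>2 * L1 * h2\<^sup>2 - 2 * \<rho>)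
               / (24 * lam * L1 * real d + 24 * lam * L1\<^sup>2 * \<rho> * (real d + 3) ^ 3)) * \<epsilon>)"
  shows "(\<forall>k\<in>{0..N}. integrable M (\<lambda>\<omega>. (norm (saddle_op f (zhat k \<omega>)))\<^sup>2)) \<and>
    1 / (real N + 1) * (\<Sum>k=0..N. \<integral>\<omega>. (norm (saddle_op f (zhat k \<omega>)))\<^sup>2 \<partial>M) \<le> \<epsilon>\<^sup>2"
proof -
  define c where "c = lam\<^sup>2 * L1 * h2\<^sup>2 - 2 * \<rho>"
  have rho': "0 \<le> \<rho>" "\<rho> < 1 / (8 * L1)" and h2': "sqrt (2 * \<rho> / (L1 * lam\<^sup>2)) < h2" "h2 \<le> h1 / 2"
    using rho h2 by auto
  \<comment> \<open>Squaring the lower bound on \<open>h2\<close> makes the common denominator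
    \<open>c\<close> positive.\<close>
  have "2 * \<rho> / (L1 * lam\<^sup>2) < h2\<^sup>2"
    using h2'(1) h2(1) real_sqrt_less_iff[of "2 * \<rho> / (L1 * lam\<^sup>2)" "h2\<^sup>2"] by simp
  then have c: "c > 0"
    using lam L1 by (simp add: c_def field_simps)
  have d_pos: "real d > 0"
    using d by (simp add: add_pos_pos)
  have dim: "DIM((real^'n) \<times> (real^'m)) = d"
    by (simp add: d)
  have eps2: "\<epsilon> powi (-2) = 1 / \<epsilon>\<^sup>2"
    using eps by (simp add: power_int_minus field_simps)
  have t_ge': "18 * lam * \<sigma>\<^sup>2 / (L1 * c) / \<epsilon>\<^sup>2 \<le> real t"
    using t_ge unfolding c_def[symmetric] eps2 ceiling_le_iff by simp
  \<comment> \<open>The -1 under the ceiling is absorbed by counting the N + 1 iterations from 0 to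
    N.\<close>
  have N_ge': "12 * lam\<^sup>2 * L1 * r0\<^sup>2 / c / \<epsilon>\<^sup>2 \<le> real N + 1"
    using N_ge unfolding c_def[symmetric] eps2 ceiling_le_iff by simp
  \<comment> \<open>The second entry of the minimum gives D \<mu>^2 <= c \<epsilon>^2, and
    \<open>D\<close> is 24 lam L1 d plus a nonnegative summand.\<close>
  have mu': "24 * lam * L1 * real d * \<mu>\<^sup>2 \<le> c * \<epsilon>\<^sup>2"
  proof -
    define D where "D = 24 * lam * L1 * real d + 24 * lam * L1\<^sup>2 * \<rho> * (real d + 3) ^ 3"
    have D: "24 * lam * L1 * real d \<le> D" "D > 0"
      using lam L1 rho' d_pos by (simp_all add: D_def add_pos_nonneg)
    have "\<mu> \<le> sqrt (c / D) * \<epsilon>"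
      using mu_le by (simp add: c_def D_def)
    then have "\<mu>\<^sup>2 \<le> (sqrt (c / D) * \<epsilon>)\<^sup>2"
      using mu by (intro power_mono) auto
    also have "\<dots> = c / D * \<epsilon>\<^sup>2"
      using c D by (simp add: power_mult_distrib)
    finally have "D * \<mu>\<^sup>2 \<le> c * \<epsilon>\<^sup>2"
      using D by (simp add: field_simps)
    moreover have "24 * lam * L1 * real d * \<mu>\<^sup>2 \<le> D * \<mu>\<^sup>2"
      using D by (intro mult_right_mono) auto
    ultimately show ?thesis
      by simp
  qed
  have "real t > 0" "real N + 1 > 0"
    using t_ge_1 by simp_all
  note constants = step_size_bounds[OF lam L1 rho' h2(1) h2'(2) h1(2) c[unfolded c_def] eps d_pos
      this t_ge'[unfolded c_def] N_ge'[unfolded c_def] mu'[unfolded c_def]]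
  interpret S: smooth_saddle f lam L1 \<mu>
    using lam L1 mu f_diff f_Lip by unfold_locales
  interpret prob_space M
    by (rule prob)
  have "h1 * (lam * L1) \<le> 1"
    using h1 lam L1 by (simp add: field_simps)
  \<comment> \<open>The variance hypothesis is recentred from F_\<mu> to \<Phi>, and positivity of
    the gain supplies \<open>margin\<close>.\<close>
  then interpret Z: zo_extragradient f lam L1 \<mu> M uhat u z0 zs h1 h2 \<sigma> \<rho> t N
    using S.zo_oracle_variance[OF variance] rho' weak_Minty indep uhat_law u_law t_ge_1 h1(1) h2(1)
      less_imp_le[OF constants(1)]
    by unfold_locales
  have zhat_eq: "zhat k \<omega> = Z.zhat k \<omega>" for k \<omega>
    by (simp add: zhat Z.zhat_eq_zoeg_zhat)
  have gain: "Z.gain > 0"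
    using constants(1) by (simp add: Z.gain_def)
  have "1 / (real N + 1) * (\<Sum>k=0..N. \<integral>\<omega>. (norm (saddle_op f (zhat k \<omega>)))\<^sup>2 \<partial>M)
      \<le> 2 * ((r0\<^sup>2 / (real N + 1) + Z.loss) / Z.gain) + 2 * (lam * L1\<^sup>2 * \<mu>\<^sup>2 * real d)"
    using Z.saddle_sum_bound(2)[OF gain] unfolding zhat_eq r0 dim .
  also have "\<dots> \<le> \<epsilon>\<^sup>2"
    using constants(2) unfolding Z.loss_def Z.gain_def Z.bias_def Z.s2_def dim .
  finally show ?thesis
    using Z.saddle_sum_bound(1)[OF gain] by (simp add: zhat_eq)
qed

end
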